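(* Let $n,k,d$ be integers with $2\le d<k$ and $n > \left(1+\frac{d}{2}\right)(k-d+2)$. If $\mathcal{F}\subseteq \binom{[n]}{k}$ is a nontrivial $d$-wise intersecting family, then $$|\mathcal{F}| \le \max\left\{|\mathcal{H}(n,k,d)|,\ |\mathcal{A}(n,k,d)|\right\}.$$ Furthermore, equality holds only if $\mathcal{F}$ is isomorphic to one of $\mathcal{A}(n,k,d)$ or $\mathcal{H}(n,k,d)$.
   Context: Notation: $[n]=\{1,\dots,n\}$, $[a,b]=\{a,a+1,\dots,b\}$, and $\binom{[n]}{k}$ is the set of all $k$-element subsets of $[n]$. A family $\mathcal{F}\subseteq 2^{[n]}$ is $d$-wise $t$-intersecting if $|F_1\cap\cdots\cap F_d|\ge t$ for all $F_1,\dots,F_d\in\mathcal{F}$; it is nontrivial $d$-wise $t$-intersecting if in addition $|\bigcap_{F\in\mathcal{F}}F|<t$. When $t=1$ one says (nontrivial) $d$-wise intersecting. Two families of subsets of $[n]$ are isomorphic if one is the image of the other under a permutation of $[n]$. Define $$\mathcal{A}(n,k,d)=\left\{A\in\binom{[n]}{k}: |A\cap[d+1]|\ge d\right\},$$ $$\mathcal{H}(n,k,d)=\left\{A\in\binom{[n]}{k}: [d-1]\subset A,\ A\cap[d,k+1]\ne\emptyset\right\}\cup\left\{[k+1]\setminus\{i\}: i\in[d-1]\right\}.$$ *)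

theory Defs
  imports Complex_Main "HOL-Library.Ramsey" "HOL-Combinatorics.Permutations"
begin

(* The members G 1, ..., G d of the family need not be distinct. *)
definition dwise_t_intersecting :: "nat \<Rightarrow> nat \<Rightarrow> nat set set \<Rightarrow> bool" where
  "dwise_t_intersecting d t F \<longleftrightarrow>
     (\<forall>G :: nat \<Rightarrow> nat set. (\<forall>i\<in>{1..d}. G i \<in> F) \<longrightarrow> t \<le> card (\<Inter>i\<in>{1..d}. G i))"

(* The intersection of all members is taken inside the ground set {1..n}; in particular
   the intersection of the empty family is {1..n}. *)
definition nontrivial_dwise_t_intersecting :: "nat \<Rightarrow> nat \<Rightarrow> nat \<Rightarrow> nat set set \<Rightarrow> bool" where
  "nontrivial_dwise_t_intersecting n d t F \<longleftrightarrow>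
     dwise_t_intersecting d t F \<and> card ({1..n} \<inter> \<Inter>F) < t"

abbreviation nontrivial_dwise_intersecting :: "nat \<Rightarrow> nat \<Rightarrow> nat set set \<Rightarrow> bool" where
  "nontrivial_dwise_intersecting n d F \<equiv> nontrivial_dwise_t_intersecting n d 1 F"

definition isomorphic_families :: "nat \<Rightarrow> nat set set \<Rightarrow> nat set set \<Rightarrow> bool" where
  "isomorphic_families n F G \<longleftrightarrow> (\<exists>p. p permutes {1..n} \<and> G = (\<lambda>A. p ` A) ` F)"

definition A_family :: "nat \<Rightarrow> nat \<Rightarrow> nat \<Rightarrow> nat set set" where
  "A_family n k d = {A \<in> nsets {1..n} k. d \<le> card (A \<inter> {1..d+1})}"

definition H_family :: "nat \<Rightarrow> nat \<Rightarrow> nat \<Rightarrow> nat set set" where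
  "H_family n k d =
     {A \<in> nsets {1..n} k. {1..d-1} \<subseteq> A \<and> A \<inter> {d..k+1} \<noteq> {}} \<union>
     {{1..k+1} - {i} | i. i \<in> {1..d-1}}"

end

theory Submission
  imports Defs
begin

text \<open>
Put \<open>t = d - 1\<close>.  Any two members \<open>A\<close>, \<open>B\<close> of a nontrivial \<open>d\<close>-wise intersecting family
share at least \<open>t\<close> elements: for each element of \<open>A \<inter> B\<close> some member avoids it, and if \<open>A \<inter> B\<close>
had at most \<open>d - 2\<close> elements, these members together with \<open>A\<close> and \<open>B\<close> would be at most \<open>d\<close>
members with empty intersection.  The theorem therefore follows from a statement of Ahlswede
and Khachatrian: for \<open>2n > (t + 3)(k + 1 - t)\<close>, a largest \<open>t\<close>-intersecting family of \<open>k\<close>-sets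
whose members have no \<open>t\<close>-set in common is a copy of the family \<open>\<A>\<close> or of the family \<open>\<H>\<close>
(\<open>optimal_extremal\<close>).

\<^bold>\<open>Shifting.\<close>  Let \<open>F\<close> be a largest such family.  The shift \<open>S\<^sub>i\<^sub>j\<close>, which replaces \<open>j\<close> by \<open>i < j\<close>
where possible, keeps the size and the \<open>t\<close>-intersection property and lowers the sum of all
elements.  If \<open>S\<^sub>i\<^sub>j F\<close> is a copy of \<open>\<A>\<close> or \<open>\<H>\<close> then so is \<open>F\<close>: the members whose preimage is
ambiguous must all have been shifted or all have stayed, because two of them that meet in only
\<open>t\<close> elements are forced to the same side, and this relation is connected
(\<open>extremal_unshift\<close>; the connectedness is that of Kneser graphs, \<open>disjoint_sets_constant\<close>).  So
induction on the sum of all elements applies unless each shift either fixes \<open>F\<close> or creates a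
common \<open>t\<close>-set.  In the latter event all members contain a fixed \<open>(t-1)\<close>-set and meet a fixed pair
\<open>{i, j}\<close>; moving these \<open>t + 1\<close> elements to \<open>1, \<dots>, t + 1\<close> makes all shifts among the remaining
elements harmless.  In both cases what remains is a family closed under all exchanges of an
element \<open>j \<ge> t + 2\<close> for a smaller one (locale \<open>nearly_shifted\<close>).

\<^bold>\<open>Pulling.\<close>  Let \<open>m\<close> be least such that membership in \<open>F\<close> depends only on the trace on \<open>{1..m}\<close>,
where \<open>m \<ge> t + 2\<close>.
If \<open>m = t + 2\<close>, then \<open>F\<close> lies in a copy of \<open>\<A>\<close>.  Otherwise some trace \<open>E\<close> contains \<open>m\<close> although
\<open>E - {m}\<close> is not a trace.  Adding \<open>E - {m}\<close> can only violate the intersection property with such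
traces \<open>G\<close> that satisfy \<open>|E \<inter> G| = t\<close>, and then \<open>E \<union> G = {1..m}\<close>, so that \<open>|E| + |G| = m + t\<close>.
Hence one may pull the traces of one size and delete those of the complementary size
(\<open>pull\<close>).  As \<open>F\<close> is largest, none of these operations enlarges it; doing it in
both directions is contradictory when the two sizes differ, and when they agree, an average over
the elements of \<open>{1..m-1}\<close> contradicts the bound on \<open>n\<close> (\<open>no_interior_conflict\<close>).  The only
operations that could create a common \<open>t\<close>-set involve traces that omit at most one element of
\<open>{1..m}\<close>, with \<open>m \<le> k + 1\<close>; such conflicts determine \<open>F\<close> completely (\<open>boundary_conflict\<close>): it is a member
of a chain of families that interpolates between \<open>\<A>\<close> and \<open>\<H>\<close>.  The sizes along this
chain have no maximum in the interior (\<open>optimal_hm_family\<close>), so \<open>F\<close> is a copy of \<open>\<A>\<close> or \<open>\<H>\<close>.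
\<close>

section \<open>Shifting\<close>

definition t_intersecting :: "nat \<Rightarrow> 'a set set \<Rightarrow> bool" where
  "t_intersecting t F \<longleftrightarrow> (\<forall>A\<in>F. \<forall>B\<in>F. t \<le> card (A \<inter> B))"

definition shift_set :: "'a \<Rightarrow> 'a \<Rightarrow> 'a set set \<Rightarrow> 'a set \<Rightarrow> 'a set" where
  "shift_set i j F A =
     (if j \<in> A \<and> i \<notin> A \<and> insert i (A - {j}) \<notin> F then insert i (A - {j}) else A)"

definition shift :: "'a \<Rightarrow> 'a \<Rightarrow> 'a set set \<Rightarrow> 'a set set" where
  "shift i j F = shift_set i j F ` F"

lemma card_exchange:
  assumes "finite A" "j \<in> A" "i \<notin> A"
  shows "card (insert i (A - {j})) = card A"
  using assms by (simp add: card.insert_remove card_Suc_Diff1 del: card_Diff_insert)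

lemma exchange_in_nsets:
  assumes "A \<in> nsets U k" "j \<in> A" "i \<notin> A" "i \<in> U"
  shows "insert i (A - {j}) \<in> nsets U k"
  using assms card_exchange[of A j i] by (auto simp: nsets_def)

text \<open>If one of two sets moves and the other stays, their images cannot agree: a set moves only when
  its image is not yet present.\<close>
lemma inj_on_shift_set: "inj_on (shift_set i j F) F"
proof (rule inj_onI)
  fix A B assume "A \<in> F" "B \<in> F" "shift_set i j F A = shift_set i j F B"
  moreover have "A = B" if "insert i (A - {j}) = insert i (B - {j})" "j \<in> A" "i \<notin> A" "j \<in> B" "i \<notin> B"
    using that by (metis Diff_insert_absorb insert_Diff insertCI insert_commute insert_ident)
  ultimately show "A = B"
    unfolding shift_set_def by (auto split: if_splits)
qed

lemma card_shift: "card (shift i j F) = card F"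
  unfolding shift_def by (rule card_image[OF inj_on_shift_set])

lemma shift_subset_nsets:
  assumes "F \<subseteq> nsets U k" "i \<in> U"
  shows "shift i j F \<subseteq> nsets U k"
  using assms exchange_in_nsets[of _ U k j i] by (auto simp: shift_def shift_set_def)

text \<open>The critical case is a set \<open>A\<close> that moves and a set \<open>B\<close> that stays although it contains \<open>j\<close>
  and not \<open>i\<close>.  Then \<open>B\<close> stays because its exchanged copy is already a member, and \<open>A\<close> meets
  that copy exactly where the moved \<open>A\<close> meets \<open>B\<close>.\<close>
lemma t_intersecting_shift:
  assumes "t_intersecting t F" and fin: "\<And>A. A \<in> F \<Longrightarrow> finite A"
  shows "t_intersecting t (shift i j F)"
proof -
  have int: "t \<le> card (A \<inter> B)" if "A \<in> F" "B \<in> F" for A B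
    using assms(1) that by (auto simp: t_intersecting_def)
  have mixed: "t \<le> card (insert i (A - {j}) \<inter> B)"
    if A: "A \<in> F" "j \<in> A" "i \<notin> A" and B: "B \<in> F"
      and stays: "\<not> (j \<in> B \<and> i \<notin> B \<and> insert i (B - {j}) \<notin> F)" for A B
  proof -
    have fAB: "finite (A \<inter> B)" using fin A by blast
    consider "j \<notin> B" | "j \<in> B" "i \<in> B" | "j \<in> B" "i \<notin> B" "insert i (B - {j}) \<in> F"
      using stays by blast
    then show ?thesis
    proof cases
      case 1
      then have "A \<inter> B \<subseteq> insert i (A - {j}) \<inter> B" using A by blast
      then show ?thesis
        using int[OF A(1) B] card_mono[of "insert i (A - {j}) \<inter> B" "A \<inter> B"] fin[OF A(1)] by simp
    next
      case 2
      then have "insert i (A - {j}) \<inter> B = insert i (A \<inter> B - {j})" using A by blast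
      then show ?thesis using int[OF A(1) B] card_exchange[OF fAB, of j i] A 2 by simp
    next
      case 3
      then have "insert i (A - {j}) \<inter> B = A \<inter> insert i (B - {j})" using A by blast
      then show ?thesis using int[OF A(1) 3(3)] by simp
    qed
  qed
  have both: "t \<le> card (insert i (A - {j}) \<inter> insert i (B - {j}))"
    if "A \<in> F" "j \<in> A" "i \<notin> A" "B \<in> F" "j \<in> B" for A B
  proof -
    have "insert i (A - {j}) \<inter> insert i (B - {j}) = insert i (A \<inter> B - {j})" using that by blast
    then show ?thesis using int[of A B] card_exchange[of "A \<inter> B" j i] fin[of A] that by simp
  qed
  have "t \<le> card (shift_set i j F A \<inter> shift_set i j F B)" if "A \<in> F" "B \<in> F" for A B
  proof (cases "j \<in> A \<and> i \<notin> A \<and> insert i (A - {j}) \<notin> F")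
    case a: True
    show ?thesis
    proof (cases "j \<in> B \<and> i \<notin> B \<and> insert i (B - {j}) \<notin> F")
      case True
      then show ?thesis using a both that by (auto simp: shift_set_def)
    next
      case False
      then have "shift_set i j F A = insert i (A - {j})" "shift_set i j F B = B"
        using a by (auto simp: shift_set_def)
      then show ?thesis using a False mixed[of A B] that by metis
    qed
  next
    case a: False
    show ?thesis
    proof (cases "j \<in> B \<and> i \<notin> B \<and> insert i (B - {j}) \<notin> F")
      case True
      then have "shift_set i j F B = insert i (B - {j})" "shift_set i j F A = A"
        using a by (auto simp: shift_set_def)
      then show ?thesis using a True mixed[of B A] that by (metis Int_commute)
    next
      case False
      then show ?thesis using a int that by (auto simp: shift_set_def)
    qed
  qed
  then show ?thesis by (auto simp: t_intersecting_def shift_def)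
qed

text \<open>The potential for the inductions: it decreases under every shift towards smaller numbers that changes
  the family.\<close>
definition weight :: "nat set set \<Rightarrow> nat" where
  "weight F = (\<Sum>A\<in>F. \<Sum>A)"

lemma sum_exchange_less:
  fixes i j :: nat
  assumes "finite A" "j \<in> A" "i \<notin> A" "i < j"
  shows "\<Sum>(insert i (A - {j})) < \<Sum>A"
proof -
  have "\<Sum>A = j + \<Sum>(A - {j})" using assms by (simp add: sum.remove)
  then show ?thesis using assms by (simp add: sum.insert_if)
qed

lemma weight_shift_less:
  assumes "finite F" "\<And>A. A \<in> F \<Longrightarrow> finite A" "i < j" "shift i j F \<noteq> F"
  shows "weight (shift i j F) < weight F"
proof -
  have le: "\<Sum>(shift_set i j F A) \<le> \<Sum>A" if "A \<in> F" for A
    using sum_exchange_less[of A j i] assms that by (auto simp: shift_set_def intro: less_imp_le)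
  obtain A where A: "A \<in> F" "shift_set i j F A \<noteq> A"
    using assms(4) by (force simp: shift_def)
  then have "\<Sum>(shift_set i j F A) < \<Sum>A"
    using sum_exchange_less[of A j i] assms by (auto simp: shift_set_def split: if_splits)
  then have "(\<Sum>A\<in>F. \<Sum>(shift_set i j F A)) < (\<Sum>A\<in>F. \<Sum>A)"
    using le A assms(1) by (intro sum_strict_mono_ex1) auto
  then show ?thesis
    by (simp add: weight_def shift_def sum.reindex[OF inj_on_shift_set])
qed

lemma shift_stable_exchange:
  assumes "shift i j F = F" "A \<in> F" "j \<in> A" "i \<notin> A"
  shows "insert i (A - {j}) \<in> F"
proof (rule ccontr)
  assume "insert i (A - {j}) \<notin> F"
  then have "shift_set i j F A = insert i (A - {j})" using assms by (simp add: shift_set_def)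
  then show False using assms \<open>insert i (A - {j}) \<notin> F\<close> unfolding shift_def by (metis imageI)
qed

text \<open>A set \<open>T\<close> that becomes common to all members only through shifting forces a small cover of the
  original family.\<close>
lemma t_set_in_shift:
  assumes nt: "\<not> (\<forall>A\<in>F. T \<subseteq> A)" and all: "\<forall>A\<in>shift i j F. T \<subseteq> A" and "i \<noteq> j"
  shows "i \<in> T" "j \<notin> T" "\<And>A. A \<in> F \<Longrightarrow> T - {i} \<subseteq> A" "\<And>A. A \<in> F \<Longrightarrow> i \<in> A \<or> j \<in> A"
proof -
  have S: "T \<subseteq> shift_set i j F A" if "A \<in> F" for A
    using all that by (auto simp: shift_def)
  show i: "i \<in> T"
  proof (rule ccontr)
    assume "i \<notin> T"
    then have "T \<subseteq> A" if "A \<in> F" for A using S[OF that] by (auto simp: shift_set_def split: if_splits)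
    then show False using nt by blast
  qed
  show "j \<notin> T"
  proof
    assume "j \<in> T"
    then have "T \<subseteq> A" if "A \<in> F" for A using S[OF that] \<open>i \<noteq> j\<close>
      by (auto simp: shift_set_def split: if_splits)
    then show False using nt by blast
  qed
  show "T - {i} \<subseteq> A" if "A \<in> F" for A using S[OF that]
    by (auto simp: shift_set_def split: if_splits)
  show "i \<in> A \<or> j \<in> A" if "A \<in> F" for A using S[OF that] i
    by (auto simp: shift_set_def split: if_splits)
qed

section \<open>Recovering a family from its shift\<close>

text \<open>For a shifted family \<open>G\<close>, these are the members whose preimage is ambiguous: each of them arises
  either from itself or from the set with \<open>j\<close> in place of \<open>i\<close>, and exactly one of the two was a
  member before.\<close>
definition moved :: "'a \<Rightarrow> 'a \<Rightarrow> 'a set set \<Rightarrow> 'a set set" where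
  "moved i j G = {A \<in> G. i \<in> A \<and> j \<notin> A \<and> insert j (A - {i}) \<notin> G}"

lemma shift_contains:
  assumes "A \<in> F" "i \<in> A \<or> j \<notin> A \<or> insert i (A - {j}) \<in> F"
  shows "A \<in> shift i j F"
proof -
  have "shift_set i j F A = A" using assms by (auto simp: shift_set_def)
  then show ?thesis using assms by (metis imageI shift_def)
qed

lemma in_shiftE:
  assumes "A \<in> shift i j F"
  obtains "A \<in> F" | B where "B \<in> F" "j \<in> B" "i \<notin> B" "A = insert i (B - {j})" "A \<notin> F"
  using assms by (auto simp: shift_def shift_set_def split: if_splits)

lemma moved_dichotomy:
  assumes "A \<in> moved i j (shift i j F)" "A \<notin> F" "i \<noteq> j"
  shows "insert j (A - {i}) \<in> F"
proof -
  obtain B where B: "B \<in> F" "j \<in> B" "i \<notin> B" "A = insert i (B - {j})"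
    using assms in_shiftE[of A i j F] by (auto simp: moved_def)
  then have "insert j (A - {i}) = B" using assms by auto
  then show ?thesis using B by simp
qed

text \<open>If \<open>A\<close> stayed while \<open>B\<close> came from \<open>B - {i} \<union> {j}\<close>, then \<open>A\<close> and this preimage meet in
  \<open>A \<inter> B\<close> without \<open>i\<close>, which is too small.\<close>
lemma moved_same_side:
  assumes "t_intersecting t F" "\<And>A. A \<in> F \<Longrightarrow> finite A" "i \<noteq> j"
    and A: "A \<in> moved i j (shift i j F)" and B: "B \<in> moved i j (shift i j F)"
    and small: "card (A \<inter> B) \<le> t"
  shows "A \<in> F \<longleftrightarrow> B \<in> F"
proof -
  have *: False if "A \<in> F" "B \<notin> F" "A \<in> moved i j (shift i j F)" "B \<in> moved i j (shift i j F)"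
      "card (A \<inter> B) \<le> t" for A B
  proof -
    have "insert j (B - {i}) \<in> F" using moved_dichotomy that assms(3) by metis
    then have "t \<le> card (A \<inter> insert j (B - {i}))" using assms(1) that by (auto simp: t_intersecting_def)
    moreover have "A \<inter> insert j (B - {i}) = (A \<inter> B) - {i}" using that by (auto simp: moved_def)
    moreover have "i \<in> A \<inter> B" using that by (auto simp: moved_def)
    ultimately show False
      using that assms(2)[of A] by (metis card_Diff1_less finite_Int leD le_trans)
  qed
  show ?thesis using *[of A B] *[of B A] A B small by (auto simp: Int_commute)
qed

text \<open>If all ambiguous members came from the same side, then the shift was either trivial or the
  transposition of \<open>i\<close> and \<open>j\<close>.\<close>
lemma unshift:
  assumes fin: "finite F" and "i \<noteq> j"
    and same: "\<And>A B. A \<in> moved i j (shift i j F) \<Longrightarrow> B \<in> moved i j (shift i j F) \<Longrightarrow> A \<in> F \<longleftrightarrow> B \<in> F"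
  shows "F = shift i j F \<or> F = (`) (transpose i j) ` shift i j F"
proof -
  let ?G = "shift i j F"
  have G_mov: "shift_set i j F A \<in> moved i j ?G \<and> shift_set i j F A \<notin> F" if "A \<in> F" "shift_set i j F A \<noteq> A" for A
  proof -
    have A: "j \<in> A" "i \<notin> A" "insert i (A - {j}) \<notin> F" "shift_set i j F A = insert i (A - {j})"
      using that by (auto simp: shift_set_def split: if_splits)
    have "A \<notin> ?G"
    proof
      assume "A \<in> ?G"
      then obtain B where B: "B \<in> F" "A = shift_set i j F B" by (auto simp: shift_def)
      then have "B = A" using A by (auto simp: shift_set_def split: if_splits)
      then show False using B that by simp
    qed
    moreover have "insert j (insert i (A - {j}) - {i}) = A" using A by auto
    moreover have "insert i (A - {j}) \<in> ?G" using that(1) A(4) unfolding shift_def by (metis imageI)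
    ultimately show ?thesis using A \<open>i \<noteq> j\<close> by (simp add: moved_def)
  qed
  show ?thesis
  proof (cases "\<exists>A\<in>moved i j ?G. A \<notin> F")
    case False
    then have "shift_set i j F A = A" if "A \<in> F" for A using G_mov that by blast
    then have "?G = F" by (simp add: shift_def)
    then show ?thesis by simp
  next
    case True
    then have none: "A \<notin> F" if "A \<in> moved i j ?G" for A using same that by blast
    have tr: "transpose i j ` A = insert j (A - {i})" if "i \<in> A" "j \<notin> A" for A
      using that by (auto simp: transpose_def image_def)
    have tr': "transpose i j ` A = insert i (A - {j})" if "j \<in> A" "i \<notin> A" for A
      using that by (auto simp: transpose_def image_def)
    have sub: "F \<subseteq> (`) (transpose i j) ` ?G"
    proof
      fix B assume B: "B \<in> F"
      have "transpose i j ` B \<in> ?G"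
      proof (cases "shift_set i j F B = B")
        case False
        then have "j \<in> B" "i \<notin> B" "shift_set i j F B = insert i (B - {j})"
          by (auto simp: shift_set_def split: if_splits)
        then show ?thesis using B tr' unfolding shift_def by (metis imageI)
      next
        case stay: True
        then have BG: "B \<in> ?G" using B unfolding shift_def by (metis imageI)
        consider "i \<in> B \<longleftrightarrow> j \<in> B" | "i \<in> B" "j \<notin> B" | "j \<in> B" "i \<notin> B" by blast
        then show ?thesis
        proof cases
          case 1
          then have "transpose i j ` B = B"
            by (auto simp: transpose_image_eq)
          then show ?thesis using BG by simp
        next
          case 2
          then show ?thesis using none[of B] B BG tr by (auto simp: moved_def)
        next
          case 3
          then have "insert i (B - {j}) \<in> F" using stay by (auto simp: shift_set_def split: if_splits)
          then have "insert i (B - {j}) \<in> ?G" by (rule shift_contains) simp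
          then show ?thesis using tr' 3 by simp
        qed
      qed
      then show "B \<in> (`) (transpose i j) ` ?G"
        by (rule rev_image_eqI) (simp add: image_comp)
    qed
    have "card ((`) (transpose i j) ` ?G) \<le> card ?G"
      by (rule card_image_le) (simp add: fin shift_def)
    then have "F = (`) (transpose i j) ` ?G"
      using sub fin card_shift[of i j F] by (intro card_seteq) (auto simp: shift_def)
    then show ?thesis by simp
  qed
qed

text \<open>The Kneser graph of \<open>s\<close>-subsets of a set with at least \<open>2s + 1\<close> elements is connected and not
  bipartite.  The reason used here: two \<open>s\<close>-sets that differ in one element occupy \<open>s + 1\<close> points
  together, hence have a common disjoint \<open>s\<close>-set, and any two \<open>s\<close>-sets are linked by such exchanges.
  Two predicates \<open>P\<close>, \<open>P'\<close> are admitted because the two disjoint sets may play different roles.\<close>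
lemma disjoint_sets_constant:
  assumes "finite N" "2 * s + 1 \<le> card N"
    and link: "\<And>A B. A \<in> nsets N s \<Longrightarrow> B \<in> nsets N s \<Longrightarrow> A \<inter> B = {} \<Longrightarrow> P A \<longleftrightarrow> P' B"
    and "A \<in> nsets N s" "B \<in> nsets N s"
  shows "P A \<longleftrightarrow> P' B"
proof -
  have avoid: "\<exists>C\<in>nsets N s. C \<inter> W = {}" if "W \<subseteq> N" "card W \<le> s + 1" for W
  proof -
    have "s \<le> card (N - W)" using that assms(1,2) by (simp add: card_Diff_subset finite_subset)
    then obtain C where "C \<subseteq> N - W" "card C = s" "finite C" by (rule obtain_subset_with_card_n)
    then show ?thesis by (auto simp: nsets_def)
  qed
  have PP: "P A \<longleftrightarrow> P A'" if "A \<in> nsets N s" "A' \<in> nsets N s" for A A'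
    using that
  proof (induction "card (A - A')" arbitrary: A rule: less_induct)
    case less
    have fin: "finite A" "finite A'" "card A = s" "card A' = s" "A \<subseteq> N" "A' \<subseteq> N"
      using less.prems by (auto simp: nsets_def)
    show ?case
    proof (cases "A = A'")
      case False
      then obtain a where a: "a \<in> A" "a \<notin> A'" using fin by (metis card_subset_eq subsetI)
      have "\<not> A' \<subseteq> A" using fin False card_subset_eq by metis
      then obtain b where b: "b \<in> A'" "b \<notin> A" by blast
      let ?A = "insert b (A - {a})"
      have A2: "?A \<in> nsets N s" using exchange_in_nsets[OF less.prems(1), of a b] a b fin by blast
      have "?A - A' = A - A' - {a}" using b by blast
      then have "card (?A - A') < card (A - A')"
        using a fin by (metis DiffI card_Diff1_less finite_Diff)
      then have "P ?A \<longleftrightarrow> P A'" using less.hyps A2 less.prems by blast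
      moreover obtain C where "C \<in> nsets N s" "C \<inter> insert b A = {}"
        using avoid[of "insert b A"] fin b by auto
      moreover have "P A \<longleftrightarrow> P' C" "P ?A \<longleftrightarrow> P' C"
        using link[of A C] link[of ?A C] calculation less.prems A2 by blast+
      ultimately show ?thesis by blast
    qed simp
  qed
  obtain C where "C \<in> nsets N s" "C \<inter> B = {}"
    using avoid[of B] assms(5) by (auto simp: nsets_def)
  then show ?thesis using link[of C B] PP[of A C] assms by blast
qed

lemma nsets_between:
  assumes "finite R" "X \<subseteq> R" "X \<inter> Y = {}" "card X \<le> s" "s \<le> card (R - Y)"
  shows "\<exists>Z\<in>nsets R s. X \<subseteq> Z \<and> Z \<inter> Y = {}"
proof -
  have "X \<subseteq> R - Y" using assms by blast
  then obtain Z where "X \<subseteq> Z" "Z \<subseteq> R - Y" "card Z = s"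
    using exists_subset_between[of X s "R - Y"] assms by auto
  moreover have "finite Z" using calculation(2) assms(1) finite_subset by blast
  ultimately show ?thesis by (auto simp: nsets_def)
qed

section \<open>The extremal families\<close>

text \<open>The bound on \<open>n\<close> is \<open>n > (1 + d/2)(k - d + 2)\<close> in terms of \<open>t = d - 1\<close>.\<close>
locale parameters =
  fixes n k t :: nat
  assumes t_pos: "1 \<le> t" and t_less_k: "t + 2 \<le> k" and n_bound: "(t + 3) * (k + 1 - t) < 2 * n"
begin

text \<open>This weaker bound is what the Kneser arguments and the comparisons of binomial coefficients
  need; the full strength of the assumption enters only in the averaging argument.\<close>
lemma n_large: "2 * k + 2 \<le> n + t"
proof -
  obtain r where r: "k = t + 2 + r" using t_less_k le_Suc_ex by metis
  obtain s where s: "t = Suc s" using t_pos by (metis Suc_le_D One_nat_def)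
  have "(s + 4) * (r + 3) < 2 * n" using n_bound r s by (simp add: algebra_simps)
  moreover have "(s + 4) * (r + 3) = s * r + 3 * s + 4 * r + 12" by (simp add: algebra_simps)
  ultimately have "s * r + 3 * s + 4 * r + 12 < 2 * n" by simp
  moreover have "0 \<le> s * r" by simp
  ultimately have "3 * s + 4 * r + 12 < 2 * n" by linarith
  then show ?thesis using r s by linarith
qed

text \<open>Nontriviality is required in the weak form that the members share no \<open>t\<close>-set.\<close>
definition admissible :: "nat set set \<Rightarrow> bool" where
  "admissible F \<longleftrightarrow> F \<subseteq> nsets {1..n} k \<and> t_intersecting t F \<and>
     (\<forall>T. card T = t \<longrightarrow> \<not> (\<forall>A\<in>F. T \<subseteq> A))"

definition optimal :: "nat set set \<Rightarrow> bool" where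
  "optimal F \<longleftrightarrow> admissible F \<and> (\<forall>G. admissible G \<longrightarrow> card G \<le> card F)"

text \<open>For \<open>|T| = t\<close> and \<open>|Q| = k + 1 - t\<close> this is a copy of \<open>\<H>\<close> with kernel \<open>T\<close>; for \<open>|Q| = 2\<close> it
  is a copy of \<open>\<A>\<close> on \<open>T \<union> Q\<close>.  The sizes in between give the interpolating chain.\<close>
definition hm_family :: "nat set \<Rightarrow> nat set \<Rightarrow> nat set set" where
  "hm_family T Q = {A \<in> nsets {1..n} k. T \<subseteq> A \<and> A \<inter> Q \<noteq> {}} \<union>
     {A \<in> nsets {1..n} k. \<exists>x\<in>T. A \<inter> (T \<union> Q) = T \<union> Q - {x}}"

definition near_family :: "nat set \<Rightarrow> nat set set" where
  "near_family Y = {A \<in> nsets {1..n} k. t + 1 \<le> card (A \<inter> Y)}"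

definition extremal :: "nat set set \<Rightarrow> bool" where
  "extremal F \<longleftrightarrow>
     (\<exists>T Q. T \<union> Q \<subseteq> {1..n} \<and> T \<inter> Q = {} \<and> card T = t \<and> card Q = k + 1 - t \<and> F = hm_family T Q) \<or>
     (\<exists>Y. Y \<subseteq> {1..n} \<and> card Y = t + 2 \<and> F = near_family Y)"

lemma nsetsD:
  assumes "A \<in> nsets {1..n} k"
  shows "finite A" "A \<subseteq> {1..n}" "card A = k"
  using assms by (auto simp: nsets_def)

lemma permutes_nsets:
  assumes "p permutes {1..n}" "A \<in> nsets {1..n} k"
  shows "p ` A \<in> nsets {1..n} k"
  using assms permutes_image[OF assms(1)] card_image[OF permutes_inj_on[OF assms(1)], of A]
  by (auto simp: nsets_def)

lemma image_permutes_hm_family: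
  assumes p: "p permutes {1..n}"
  shows "(`) p ` hm_family T Q = hm_family (p ` T) (p ` Q)"
proof -
  have sub: "p ` A \<in> hm_family (p ` T) (p ` Q)"
    if p: "p permutes {1..n}" and A: "A \<in> hm_family T Q" for p A T Q
  proof -
    have inj: "inj p" using p permutes_inj by blast
    have "p ` A \<in> nsets {1..n} k" using A permutes_nsets[OF p] by (auto simp: hm_family_def)
    moreover have "p ` A \<inter> (p ` T \<union> p ` Q) = p ` T \<union> p ` Q - {p x}"
      if "A \<inter> (T \<union> Q) = T \<union> Q - {x}" for x
    proof -
      have "p ` (A \<inter> (T \<union> Q)) = p ` (T \<union> Q - {x})" using that by simp
      then show ?thesis by (simp add: image_Int[OF inj] image_set_diff[OF inj] image_Un)
    qed
    ultimately show ?thesis using A by (auto simp: hm_family_def)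
  qed
  show ?thesis
  proof
    show "(`) p ` hm_family T Q \<subseteq> hm_family (p ` T) (p ` Q)" using sub[OF p] by blast
    show "hm_family (p ` T) (p ` Q) \<subseteq> (`) p ` hm_family T Q"
    proof
      fix B assume "B \<in> hm_family (p ` T) (p ` Q)"
      then have "inv p ` B \<in> hm_family T Q"
        using sub[OF permutes_inv[OF p], of B "p ` T" "p ` Q"]
        by (simp add: image_inv_f_f permutes_inj[OF p])
      moreover have "B = p ` (inv p ` B)"
        using image_f_inv_f[OF permutes_surj[OF p]] by simp
      ultimately show "B \<in> (`) p ` hm_family T Q" by blast
    qed
  qed
qed

lemma image_permutes_near_family:
  assumes p: "p permutes {1..n}"
  shows "(`) p ` near_family Y = near_family (p ` Y)"
proof -
  have sub: "p ` A \<in> near_family (p ` Y)"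
    if p: "p permutes {1..n}" and A: "A \<in> near_family Y" for p A Y
  proof -
    have "card (p ` A \<inter> p ` Y) = card (A \<inter> Y)"
      using card_image[OF permutes_inj_on[OF p], of "A \<inter> Y"] by (simp add: image_Int[OF permutes_inj[OF p]])
    then show ?thesis using A permutes_nsets[OF p] by (auto simp: near_family_def)
  qed
  show ?thesis
  proof
    show "(`) p ` near_family Y \<subseteq> near_family (p ` Y)" using sub[OF p] by blast
    show "near_family (p ` Y) \<subseteq> (`) p ` near_family Y"
    proof
      fix B assume "B \<in> near_family (p ` Y)"
      then have "inv p ` B \<in> near_family Y"
        using sub[OF permutes_inv[OF p], of B "p ` Y"]
        by (simp add: image_inv_f_f permutes_inj[OF p])
      moreover have "B = p ` (inv p ` B)"
        using image_f_inv_f[OF permutes_surj[OF p]] by simp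
      ultimately show "B \<in> (`) p ` near_family Y" by blast
    qed
  qed
qed

lemma extremal_image:
  assumes p: "p permutes {1..n}" and "extremal F"
  shows "extremal ((`) p ` F)"
proof -
  have c: "card (p ` X) = card X" for X by (rule card_image[OF permutes_inj_on[OF p]])
  have s: "p ` X \<subseteq> {1..n}" if "X \<subseteq> {1..n}" for X using that permutes_image[OF p] by blast
  from assms(2) show ?thesis unfolding extremal_def
  proof (elim disjE exE conjE)
    fix T Q assume "T \<union> Q \<subseteq> {1..n}" "T \<inter> Q = {}" "card T = t" "card Q = k + 1 - t" "F = hm_family T Q"
    then have "p ` T \<union> p ` Q \<subseteq> {1..n}" "p ` T \<inter> p ` Q = {}" "card (p ` T) = t" "card (p ` Q) = k + 1 - t"
      "(`) p ` F = hm_family (p ` T) (p ` Q)"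
      using c s image_permutes_hm_family[OF p] by (auto simp flip: image_Int[OF permutes_inj[OF p]])
    then show "(\<exists>T Q. T \<union> Q \<subseteq> {1..n} \<and> T \<inter> Q = {} \<and> card T = t \<and> card Q = k + 1 - t \<and> (`) p ` F = hm_family T Q) \<or>
      (\<exists>Y. Y \<subseteq> {1..n} \<and> card Y = t + 2 \<and> (`) p ` F = near_family Y)" by blast
  next
    fix Y assume "Y \<subseteq> {1..n}" "card Y = t + 2" "F = near_family Y"
    then have "p ` Y \<subseteq> {1..n}" "card (p ` Y) = t + 2" "(`) p ` F = near_family (p ` Y)"
      using c s image_permutes_near_family[OF p] by auto
    then show "(\<exists>T Q. T \<union> Q \<subseteq> {1..n} \<and> T \<inter> Q = {} \<and> card T = t \<and> card Q = k + 1 - t \<and> (`) p ` F = hm_family T Q) \<or>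
      (\<exists>Y. Y \<subseteq> {1..n} \<and> card Y = t + 2 \<and> (`) p ` F = near_family Y)" by blast
  qed
qed

section \<open>Uniqueness of preimages of extremal families under a shift\<close>

text \<open>Only a shift from outside \<open>Y\<close> into \<open>Y\<close> leaves an ambiguity: in all other positions the family
  is closed under replacing \<open>i\<close> by \<open>j\<close>.\<close>
lemma moved_near_family:
  assumes Y: "Y \<subseteq> {1..n}" "card Y = t + 2" and ij: "i \<noteq> j" "j \<in> {1..n}"
    and A: "A \<in> moved i j (near_family Y)"
  shows "i \<in> Y" "j \<notin> Y" "\<exists>y\<in>Y - {i}. \<exists>Z\<in>nsets ({1..n} - Y - {j}) (k - t - 1). A = (Y - {y}) \<union> Z"
proof -
  let ?B = "insert j (A - {i})"
  have Ad: "A \<in> nsets {1..n} k" "t + 1 \<le> card (A \<inter> Y)" "i \<in> A" "j \<notin> A" "?B \<notin> near_family Y"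
    using A by (auto simp: moved_def near_family_def)
  have finY: "finite Y" using Y finite_subset by blast
  have fA: "finite A" using Ad nsetsD by blast
  have "?B \<in> nsets {1..n} k" using exchange_in_nsets[OF Ad(1) Ad(3,4) ij(2)] .
  then have small: "card (?B \<inter> Y) \<le> t" using Ad(5) by (auto simp: near_family_def)
  show i: "i \<in> Y"
  proof (rule ccontr)
    assume "i \<notin> Y"
    then have "A \<inter> Y \<subseteq> ?B \<inter> Y" by blast
    then have "card (A \<inter> Y) \<le> card (?B \<inter> Y)" using finY by (intro card_mono) auto
    then show False using small Ad by simp
  qed
  show j: "j \<notin> Y"
  proof
    assume "j \<in> Y"
    then have "?B \<inter> Y = insert j (A \<inter> Y - {i})" by blast
    then have "card (?B \<inter> Y) = card (A \<inter> Y)" using card_exchange[of "A \<inter> Y" i j] i Ad fA by simp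
    then show False using small Ad by simp
  qed
  have "?B \<inter> Y = A \<inter> Y - {i}" using j by blast
  then have "card (A \<inter> Y) - 1 \<le> t" using small i Ad fA by (simp add: card_Diff_singleton)
  then have cAY: "card (A \<inter> Y) = t + 1" using Ad by simp
  then have "card (Y - A) = 1" using Y finY card_Diff_subset_Int[of Y A] by (simp add: Int_commute)
  then obtain y where y: "Y - A = {y}" using card_1_singletonE by blast
  have "A = (Y - {y}) \<union> (A - Y)" using y by blast
  moreover have "y \<in> Y - {i}" using y Ad by blast
  moreover have "card (A - Y) = k - t - 1" using cAY fA nsetsD[OF Ad(1)] card_Diff_subset_Int[of A Y] by simp
  then have "A - Y \<in> nsets ({1..n} - Y - {j}) (k - t - 1)"
    using Ad nsetsD[OF Ad(1)] by (auto simp: nsets_def)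
  ultimately show "\<exists>y\<in>Y - {i}. \<exists>Z\<in>nsets ({1..n} - Y - {j}) (k - t - 1). A = (Y - {y}) \<union> Z" by blast
qed

lemma moved_near_familyI:
  assumes Y: "Y \<subseteq> {1..n}" "card Y = t + 2" and i: "i \<in> Y" "j \<notin> Y"
    and y: "y \<in> Y - {i}" and Z: "Z \<in> nsets ({1..n} - Y - {j}) (k - t - 1)"
  shows "(Y - {y}) \<union> Z \<in> moved i j (near_family Y)"
proof -
  have finY: "finite Y" using Y finite_subset by blast
  have Zd: "finite Z" "Z \<inter> Y = {}" "j \<notin> Z" "Z \<subseteq> {1..n}" "card Z = k - t - 1" using Z by (auto simp: nsets_def)
  have cy: "card (Y - {y}) = t + 1" using Y y finY by (simp add: card_Diff_singleton)
  have "card ((Y - {y}) \<union> Z) = k"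
    using Zd cy finY t_less_k by (subst card_Un_disjoint) auto
  then have "(Y - {y}) \<union> Z \<in> nsets {1..n} k" using Zd Y finY by (auto simp: nsets_def)
  moreover have "((Y - {y}) \<union> Z) \<inter> Y = Y - {y}" using Zd by blast
  moreover have "insert j ((Y - {y}) \<union> Z - {i}) \<inter> Y = Y - {y} - {i}" using Zd i by blast
  moreover have "card (Y - {y} - {i}) = t" using cy i y finY by (simp add: card_Diff_singleton)
  ultimately show ?thesis using cy i y Zd by (auto simp: moved_def near_family_def)
qed

text \<open>Ambiguous members consist of \<open>Y - {y}\<close> and a set \<open>Z\<close> outside \<open>Y\<close>.  For different \<open>y\<close> and
  disjoint \<open>Z\<close> two of them meet in only \<open>t\<close> elements, so the Kneser argument applies to \<open>Z\<close>.\<close>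
lemma moved_near_same_side:
  assumes F: "t_intersecting t F" "F \<subseteq> nsets {1..n} k" and ij: "i \<noteq> j" "j \<in> {1..n}"
    and Y: "Y \<subseteq> {1..n}" "card Y = t + 2" and G: "shift i j F = near_family Y"
    and A: "A \<in> moved i j (shift i j F)" and B: "B \<in> moved i j (shift i j F)"
  shows "A \<in> F \<longleftrightarrow> B \<in> F"
proof -
  let ?N = "{1..n} - Y - {j}" and ?s = "k - t - 1"
  have finY: "finite Y" using Y finite_subset by blast
  have fin: "finite A" if "A \<in> F" for A using that F nsetsD by blast
  note mA = moved_near_family[OF Y ij A[unfolded G]] and mB = moved_near_family[OF Y ij B[unfolded G]]
  have i: "i \<in> Y" "j \<notin> Y" using mA by blast+
  have "card ?N = n - (t + 2) - 1"
    using Y i ij finY by (simp add: card_Diff_subset card_Diff_singleton)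
  then have N: "2 * ?s + 1 \<le> card ?N" using n_large t_less_k by linarith
  have const: "((Y - {y}) \<union> Z \<in> F) \<longleftrightarrow> ((Y - {y'}) \<union> Z' \<in> F)"
    if "y \<in> Y - {i}" "y' \<in> Y - {i}" "y \<noteq> y'" "Z \<in> nsets ?N ?s" "Z' \<in> nsets ?N ?s" for y y' Z Z'
  proof (rule disjoint_sets_constant[where N = ?N and s = ?s and
        P = "\<lambda>Z. (Y - {y}) \<union> Z \<in> F" and P' = "\<lambda>Z. (Y - {y'}) \<union> Z \<in> F"])
    fix C D assume CD: "C \<in> nsets ?N ?s" "D \<in> nsets ?N ?s" "C \<inter> D = {}"
    have "((Y - {y}) \<union> C) \<inter> ((Y - {y'}) \<union> D) = Y - {y} - {y'}"
      using CD by (auto simp: nsets_def)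
    moreover have "card (Y - {y} - {y'}) = t" using Y finY that by (simp add: card_Diff_singleton)
    ultimately show "((Y - {y}) \<union> C \<in> F) \<longleftrightarrow> ((Y - {y'}) \<union> D \<in> F)"
      using moved_near_familyI[OF Y i] that CD G
      by (intro moved_same_side[OF F(1) fin ij(1)]) auto
  qed (use that N in auto)
  obtain y Z where yZ: "y \<in> Y - {i}" "Z \<in> nsets ?N ?s" "A = (Y - {y}) \<union> Z" using mA(3) by blast
  obtain y' Z' where yZ': "y' \<in> Y - {i}" "Z' \<in> nsets ?N ?s" "B = (Y - {y'}) \<union> Z'" using mB(3) by blast
  have "card (Y - {i} - {y}) = t" using Y finY i yZ by (simp add: card_Diff_singleton)
  then have "Y - {i} - {y} \<noteq> {}" using t_pos by (metis card.empty not_one_le_zero)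
  then obtain w where w: "w \<in> Y - {i}" "w \<noteq> y" by blast
  show ?thesis
  proof (cases "y = y'")
    case True
    then show ?thesis using const[of y w Z Z] const[of w y Z Z'] yZ yZ' w by auto
  next
    case False
    then show ?thesis using const[of y y' Z Z'] yZ yZ' by auto
  qed
qed

end

context parameters
begin

lemma hm_family_cases:
  assumes TQ: "T \<union> Q \<subseteq> {1..n}" "T \<inter> Q = {}" "card T = t" "card Q = k + 1 - t"
    and A: "A \<in> hm_family T Q"
  obtains "T \<subseteq> A" "A \<inter> Q \<noteq> {}" | x where "x \<in> T" "A = T \<union> Q - {x}"
proof -
  have fin: "finite T" "finite Q" using TQ finite_subset by auto
  have cTQ: "card (T \<union> Q) = k + 1" using TQ fin t_less_k by (simp add: card_Un_disjoint)
  have "A = T \<union> Q - {x}" if "x \<in> T" "A \<inter> (T \<union> Q) = T \<union> Q - {x}" for x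
  proof -
    have Ak: "finite A" "card A = k" using A nsetsD by (auto simp: hm_family_def)
    have "card (T \<union> Q - {x}) = k" using cTQ that fin by (simp add: card_Diff_singleton)
    moreover have "T \<union> Q - {x} \<subseteq> A" using that by blast
    ultimately show ?thesis using card_subset_eq[of A "T \<union> Q - {x}"] Ak by simp
  qed
  then show thesis using A that unfolding hm_family_def by blast
qed

lemma co_singleton_in_hm_family:
  assumes TQ: "T \<union> Q \<subseteq> {1..n}" "T \<inter> Q = {}" "card T = t" "card Q = k + 1 - t" and x: "x \<in> T"
  shows "T \<union> Q - {x} \<in> hm_family T Q"
proof -
  have fin: "finite T" "finite Q" using TQ finite_subset by auto
  have "card (T \<union> Q) = k + 1" using TQ fin t_less_k by (simp add: card_Un_disjoint)
  then have "T \<union> Q - {x} \<in> nsets {1..n} k"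
    using TQ x fin by (auto simp: nsets_def card_Diff_singleton)
  then show ?thesis using x by (auto simp: hm_family_def)
qed

lemma superset_in_hm_family:
  assumes "A \<in> nsets {1..n} k" "T \<subseteq> A" "A \<inter> Q \<noteq> {}"
  shows "A \<in> hm_family T Q"
  using assms by (auto simp: hm_family_def)

lemma union_in_nsets:
  assumes T: "T \<subseteq> {1..n}" "card T = t" and Z: "Z \<in> nsets ({1..n} - T - W) (k - t)"
  shows "T \<union> Z \<in> nsets {1..n} k"
proof -
  have "finite T" using T finite_subset by auto
  moreover have "T \<inter> Z = {}" using Z by (auto simp: nsets_def)
  ultimately have "card (T \<union> Z) = k" using T Z t_less_k by (simp add: card_Un_disjoint nsets_def)
  then show ?thesis using T Z \<open>finite T\<close> by (auto simp: nsets_def)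
qed

text \<open>In the remaining positions of \<open>i\<close> and \<open>j\<close> the family is closed under replacing \<open>i\<close> by \<open>j\<close>.\<close>
lemma moved_hm_location:
  assumes TQ: "T \<union> Q \<subseteq> {1..n}" "T \<inter> Q = {}" "card T = t" "card Q = k + 1 - t"
    and ij: "i \<noteq> j" "j \<in> {1..n}" and A: "A \<in> moved i j (hm_family T Q)"
  shows "(i \<in> Q \<and> j \<notin> T \<union> Q) \<or> (i \<in> T \<and> j \<notin> T)"
proof -
  let ?B = "insert j (A - {i})"
  have Ad: "A \<in> hm_family T Q" "i \<in> A" "j \<notin> A" "?B \<notin> hm_family T Q" using A by (auto simp: moved_def)
  have An: "A \<in> nsets {1..n} k" using Ad(1) by (auto simp: hm_family_def)
  have Bn: "?B \<in> nsets {1..n} k" using exchange_in_nsets[OF An Ad(2,3) ij(2)] .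
  have Bsup: False if "T \<subseteq> ?B" "?B \<inter> Q \<noteq> {}" using superset_in_hm_family[OF Bn that] Ad by blast
  have Bco: False if "x \<in> T" "?B = T \<union> Q - {x}" for x
    using co_singleton_in_hm_family[OF TQ that(1)] that Ad by simp
  have two: "\<exists>q\<in>Q. q \<noteq> v" for v
  proof (rule ccontr)
    assume "\<not> ?thesis"
    then have "Q \<subseteq> {v}" by blast
    then have "card Q \<le> 1" using card_mono[of "{v}" Q] by simp
    then show False using TQ t_less_k by simp
  qed
  from TQ Ad(1) show ?thesis
  proof (cases rule: hm_family_cases)
    case 1
    then have "j \<notin> T" using Ad by blast
    moreover have "i \<in> T \<or> i \<in> Q \<and> j \<notin> Q"
    proof (rule ccontr)
      assume n: "\<not> ?thesis"
      then have "T \<subseteq> ?B" "?B \<inter> Q \<noteq> {}" using 1 by blast+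
      then show False by (rule Bsup)
    qed
    ultimately show ?thesis by blast
  next
    case (2 x)
    show ?thesis
    proof (cases "j \<in> T \<union> Q")
      case True
      then have j: "j = x" using 2 Ad by blast
      obtain q where "q \<in> Q" "q \<noteq> i" using two by blast
      moreover have "i \<in> T \<Longrightarrow> ?B = T \<union> Q - {i}" using 2 j ij by auto
      ultimately show ?thesis using Bco[of i] Bsup 2 j ij by blast
    next
      case False
      then show ?thesis using 2 Ad by blast
    qed
  qed
qed

text \<open>Ambiguous members either contain \<open>T\<close> and meet \<open>Q\<close> only in \<open>i\<close>, or are of the form
  \<open>T \<union> Q - {x}\<close>.  Members of different kinds meet in exactly \<open>t\<close> elements, and both kinds occur.\<close>
lemma moved_hm_same_side_Q:
  assumes F: "t_intersecting t F" "F \<subseteq> nsets {1..n} k" and ij: "i \<noteq> j" "j \<in> {1..n}"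
    and TQ: "T \<union> Q \<subseteq> {1..n}" "T \<inter> Q = {}" "card T = t" "card Q = k + 1 - t"
    and G: "shift i j F = hm_family T Q" and loc: "i \<in> Q" "j \<notin> T \<union> Q"
    and A: "A \<in> moved i j (shift i j F)" and B: "B \<in> moved i j (shift i j F)"
  shows "A \<in> F \<longleftrightarrow> B \<in> F"
proof -
  have fin: "finite T" "finite Q" using TQ finite_subset by auto
  have cTQ: "card (T \<union> Q) = k + 1" using TQ fin t_less_k by (simp add: card_Un_disjoint)
  have finF: "finite A" if "A \<in> F" for A using that F nsetsD by blast
  let ?M = "moved i j (shift i j F)"
  obtain x0 where x0: "x0 \<in> T" using TQ t_pos by (metis card.empty ex_in_conv not_one_le_zero)
  have co: "T \<union> Q - {x0} \<in> ?M"
  proof -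
    have "insert j (T \<union> Q - {x0} - {i}) \<notin> hm_family T Q"
    proof
      assume "insert j (T \<union> Q - {x0} - {i}) \<in> hm_family T Q"
      from TQ this show False
        by (cases rule: hm_family_cases) (use x0 loc TQ in auto)
    qed
    then show ?thesis using co_singleton_in_hm_family[OF TQ x0] loc x0 TQ
      by (auto simp: moved_def G)
  qed
  have sup: "\<exists>C\<in>?M. T \<subseteq> C \<and> C \<inter> Q = {i}"
  proof -
    have "{1..n} - T - Q - {j} = {1..n} - insert j (T \<union> Q)" by blast
    then have "card ({1..n} - T - Q - {j}) = n - (k + 2)"
      using cTQ TQ loc ij fin by (simp add: card_Diff_subset)
    then have "k - t - 1 \<le> card ({1..n} - T - Q - {j})" using n_large by linarith
    then obtain Z where Z: "Z \<subseteq> {1..n} - T - Q - {j}" "card Z = k - t - 1" "finite Z"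
      by (rule obtain_subset_with_card_n)
    let ?C = "insert i (T \<union> Z)"
    have iT: "i \<notin> T \<union> Z" using loc TQ Z by blast
    have "card (T \<union> Z) = k - 1" using Z fin TQ t_less_k by (subst card_Un_disjoint) auto
    then have "card ?C = k" using iT fin Z t_less_k by simp
    then have "?C \<in> nsets {1..n} k" using Z TQ loc fin by (auto simp: nsets_def)
    moreover have "insert j (?C - {i}) \<notin> hm_family T Q"
    proof
      have e: "insert j (?C - {i}) = insert j (T \<union> Z)" using iT by blast
      assume "insert j (?C - {i}) \<in> hm_family T Q"
      from TQ this[unfolded e] show False
      proof (cases rule: hm_family_cases)
        case 1
        moreover have "insert j (T \<union> Z) \<inter> Q = {}" using Z(1) loc(2) TQ(2) by auto
        ultimately show ?thesis by simp
      next
        case (2 x)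
        have "j \<in> T \<union> Q - {x}" using 2(2) by blast
        then show ?thesis using loc by blast
      qed
    qed
    ultimately have "?C \<in> ?M" using loc TQ Z ij
      by (auto simp: moved_def G intro!: superset_in_hm_family)
    moreover have "T \<subseteq> ?C" "?C \<inter> Q = {i}" using Z TQ loc by auto
    ultimately show ?thesis by blast
  qed
  have shape: "(T \<subseteq> C \<and> C \<inter> Q = {i}) \<or> (\<exists>x\<in>T. C = T \<union> Q - {x})" if C: "C \<in> ?M" for C
  proof -
    have Cd: "C \<in> hm_family T Q" "i \<in> C" "j \<notin> C" "insert j (C - {i}) \<notin> hm_family T Q"
      using C by (auto simp: moved_def G)
    have Cn: "C \<in> nsets {1..n} k" using Cd(1) by (auto simp: hm_family_def)
    from TQ Cd(1) show ?thesis
    proof (cases rule: hm_family_cases)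
      case 1
      have "\<not> insert j (C - {i}) \<inter> Q \<noteq> {}"
        using superset_in_hm_family[OF exchange_in_nsets[OF Cn Cd(2,3) ij(2)], of T Q] Cd(4) 1 loc TQ by blast
      then show ?thesis using 1 Cd loc by blast
    qed blast
  qed
  have link: "C \<in> F \<longleftrightarrow> D \<in> F"
    if "C \<in> ?M" "D \<in> ?M" "T \<subseteq> C" "C \<inter> Q = {i}" "x \<in> T" "D = T \<union> Q - {x}" for C D x
  proof -
    have "C \<inter> D = insert i (T - {x})" using that TQ loc by blast
    then have "card (C \<inter> D) = t" using that TQ fin loc t_pos by (auto simp: card_insert_if card_Diff_singleton)
    then show ?thesis using moved_same_side[OF F(1) finF ij(1)] that by simp
  qed
  obtain C0 where C0: "C0 \<in> ?M" "T \<subseteq> C0" "C0 \<inter> Q = {i}" using sup by blast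
  have "C \<in> F \<longleftrightarrow> C0 \<in> F" if "C \<in> ?M" for C
    using shape[OF that]
  proof
    assume "T \<subseteq> C \<and> C \<inter> Q = {i}"
    then show ?thesis using link[OF that co _ _ x0 refl] link[OF C0(1) co C0(2,3) x0 refl] by blast
  next
    assume "\<exists>x\<in>T. C = T \<union> Q - {x}"
    then show ?thesis using link[OF C0(1) that C0(2,3)] by blast
  qed
  then show ?thesis using A B by blast
qed

text \<open>A Kneser-type argument for the \<open>z\<close>-sets that meet \<open>Q\<close> without containing it.  The sets that contain
  \<open>u\<close> but not \<open>v\<close>, for \<open>u\<close>, \<open>v\<close> in \<open>Q\<close>, are linked to those that contain \<open>v\<close> but not \<open>u\<close> by
  disjointness outside \<open>{u, v}\<close>; classes with the same \<open>u\<close> overlap, and so all classes are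
  linked.\<close>
lemma proper_traces_constant:
  assumes R: "finite R" "2 * z + 1 \<le> card R" and Q: "Q \<subseteq> R"
    and link: "\<And>Z Z'. Z \<in> nsets R z \<Longrightarrow> Z' \<in> nsets R z \<Longrightarrow> Z \<inter> Q \<noteq> {} \<Longrightarrow> Z' \<inter> Q \<noteq> {} \<Longrightarrow>
      \<not> Q \<subseteq> Z \<Longrightarrow> \<not> Q \<subseteq> Z' \<Longrightarrow> Z \<inter> Z' = {} \<Longrightarrow> f Z \<longleftrightarrow> f Z'"
    and Z: "Z \<in> nsets R z" "Z \<inter> Q \<noteq> {}" "\<not> Q \<subseteq> Z" and Z': "Z' \<in> nsets R z" "Z' \<inter> Q \<noteq> {}" "\<not> Q \<subseteq> Z'"
  shows "f Z \<longleftrightarrow> f Z'"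
proof -
  define P where "P u v = {Z \<in> nsets R z. u \<in> Z \<and> v \<notin> Z}" for u v
  have z: "1 \<le> z" using Z by (cases z) (auto simp: nsets_def)
  have c1: "f Z \<longleftrightarrow> f Z'" if uv: "u \<in> Q" "v \<in> Q" "u \<noteq> v" and ZP: "Z \<in> P u v" "Z' \<in> P v u" for u v Z Z'
  proof -
    let ?N = "R - {u, v}"
    have "card ?N = card R - 2" using uv Q R by (subst card_Diff_subset) auto
    then have N: "2 * (z - 1) + 1 \<le> card ?N" using R z by linarith
    have "f (insert u (Z - {u})) \<longleftrightarrow> f (insert v (Z' - {v}))"
    proof (rule disjoint_sets_constant[where N = ?N and s = "z - 1" and
          P = "\<lambda>B. f (insert u B)" and P' = "\<lambda>B. f (insert v B)"])
      fix B B' assume B: "B \<in> nsets ?N (z - 1)" "B' \<in> nsets ?N (z - 1)" "B \<inter> B' = {}"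
      have nB: "u \<notin> B" "v \<notin> B" "u \<notin> B'" "v \<notin> B'" "card B = z - 1" "card B' = z - 1" "finite B" "finite B'" "B \<subseteq> R" "B' \<subseteq> R"
        using B by (auto simp: nsets_def)
      have "insert u B \<in> nsets R z" "insert v B' \<in> nsets R z" using nB z uv Q by (auto simp: nsets_def)
      then show "f (insert u B) \<longleftrightarrow> f (insert v B')"
        using B nB uv by (intro link) auto
    next
      show "Z - {u} \<in> nsets ?N (z - 1)" "Z' - {v} \<in> nsets ?N (z - 1)"
        using ZP by (auto simp: P_def nsets_def card_Diff_singleton)
    qed (use R N in auto)
    moreover have "insert u (Z - {u}) = Z" "insert v (Z' - {v}) = Z'" using ZP by (auto simp: P_def)
    ultimately show ?thesis by simp
  qed
  have ex: "\<exists>Z. Z \<in> P u v \<inter> P u w" if "u \<in> Q" "v \<in> Q" "w \<in> Q" "u \<noteq> v" "u \<noteq> w" for u v w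
  proof -
    have "card {v, w} \<le> 2" by (simp add: card_insert_if)
    then have "card R - 2 \<le> card (R - {v, w})" using diff_card_le_card_Diff[of "{v,w}" R] by simp
    then have "z \<le> card (R - {v, w})" using R z by linarith
    then show ?thesis using nsets_between[of R "{u}" "{v, w}" z] R Q that z by (auto simp: P_def)
  qed
  have c2: "f Z \<longleftrightarrow> f Z'" if uv: "u \<in> Q" "v \<in> Q" "u \<noteq> v" and ZP: "Z \<in> P u v" "Z' \<in> P u v" for u v Z Z'
    using c1[OF uv ZP(1)] c1[OF uv ZP(2)] ex[of v u u] uv by blast
  have c3: "f Z \<longleftrightarrow> f Z'"
    if "u \<in> Q" "v \<in> Q" "w \<in> Q" "u \<noteq> v" "u \<noteq> w" "Z \<in> P u v" "Z' \<in> P u w" for u v w Z Z'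
    using ex[OF that(1-5)] c2[of u v Z] c2[of u w _ Z'] that by blast
  obtain u v where uv: "u \<in> Q" "v \<in> Q" "Z \<in> P u v" using Z by (auto simp: P_def)
  obtain u' v' where uv': "u' \<in> Q" "v' \<in> Q" "Z' \<in> P u' v'" using Z' by (auto simp: P_def)
  have ne: "u \<noteq> v" "u' \<noteq> v'" using uv uv' by (auto simp: P_def)
  show ?thesis
  proof (cases "u' = u")
    case True
    then show ?thesis using c3[of u v v' Z Z'] uv uv' ne by blast
  next
    case False
    obtain W W' where W: "W \<in> P u u'" "W' \<in> P u' u" using ex[of u u' u'] ex[of u' u u] uv uv' False by blast
    have "f Z \<longleftrightarrow> f W" using c3[of u v u' Z W] uv uv' ne False W by blast
    moreover have "f W \<longleftrightarrow> f W'" using c1[of u u' W W'] uv uv' False W by blast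
    moreover have "f W' \<longleftrightarrow> f Z'" using c3[of u' u v' W' Z'] uv uv' ne False W by blast
    ultimately show ?thesis by blast
  qed
qed

text \<open>Here the ambiguous members are mainly the sets \<open>T \<union> Z\<close> with \<open>Z\<close> meeting, but not containing,
  \<open>Q - {j}\<close>; two of them with disjoint \<open>Z\<close> meet just in \<open>T\<close>.  A remaining set
  \<open>T \<union> Q - {x}\<close> is tied to any \<open>T \<union> Z\<close> with \<open>|Z \<inter> Q| = 1\<close>.\<close>
lemma moved_hm_same_side_T:
  assumes F: "t_intersecting t F" "F \<subseteq> nsets {1..n} k" and ij: "i \<noteq> j" "j \<in> {1..n}"
    and TQ: "T \<union> Q \<subseteq> {1..n}" "T \<inter> Q = {}" "card T = t" "card Q = k + 1 - t"
    and G: "shift i j F = hm_family T Q" and loc: "i \<in> T" "j \<notin> T"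
    and A: "A \<in> moved i j (shift i j F)" and B: "B \<in> moved i j (shift i j F)"
  shows "A \<in> F \<longleftrightarrow> B \<in> F"
proof -
  have fin: "finite T" "finite Q" using TQ finite_subset by auto
  have finF: "finite A" if "A \<in> F" for A using that F nsetsD by blast
  let ?M = "moved i j (shift i j F)"
  let ?R = "{1..n} - T - {j}" and ?z = "k - t" and ?Q = "Q - {j}"
  have cR: "card ?R = n - t - 1" using TQ loc ij fin by (simp add: card_Diff_subset card_Diff_singleton)
  then have R: "2 * ?z + 1 \<le> card ?R" using n_large t_less_k by linarith
  have cQ: "card ?Q = (if j \<in> Q then ?z else ?z + 1)"
    using TQ fin t_less_k by (simp add: card_Diff_singleton_if Suc_diff_le)
  define proper where "proper Z \<longleftrightarrow> Z \<in> nsets ?R ?z \<and> Z \<inter> ?Q \<noteq> {} \<and> \<not> ?Q \<subseteq> Z" for Z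
  have in_M: "T \<union> Z \<in> ?M" if "proper Z" for Z
  proof -
    have Z: "Z \<in> nsets ?R ?z" "Z \<inter> ?Q \<noteq> {}" "\<not> ?Q \<subseteq> Z" "Z \<inter> T = {}" "j \<notin> Z"
      using that by (auto simp: proper_def nsets_def)
    have "T \<union> Z \<in> hm_family T Q" using Z TQ union_in_nsets[of T Z "{j}"]
      by (intro superset_in_hm_family) auto
    moreover have "insert j (T \<union> Z - {i}) \<notin> hm_family T Q"
    proof
      assume "insert j (T \<union> Z - {i}) \<in> hm_family T Q"
      from TQ this show False
      proof (cases rule: hm_family_cases)
        case 1
        then show ?thesis using loc ij by auto
      next
        case (2 x)
        have "i \<notin> insert j (T \<union> Z - {i})" using ij by simp
        then have "x = i" using 2 loc by auto
        then have "Q \<subseteq> insert j (T \<union> Z - {i})" using 2 TQ loc by auto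
        then show ?thesis using Z TQ by blast
      qed
    qed
    ultimately show ?thesis using loc Z by (auto simp: moved_def G)
  qed
  have const: "T \<union> Z \<in> F \<longleftrightarrow> T \<union> Z' \<in> F" if "proper Z" "proper Z'" for Z Z'
  proof (rule proper_traces_constant[where R = ?R and z = ?z and Q = ?Q and f = "\<lambda>Z. T \<union> Z \<in> F"])
    fix Z Z' assume ZZ: "Z \<in> nsets ?R ?z" "Z' \<in> nsets ?R ?z" "Z \<inter> ?Q \<noteq> {}" "Z' \<inter> ?Q \<noteq> {}"
      "\<not> ?Q \<subseteq> Z" "\<not> ?Q \<subseteq> Z'" "Z \<inter> Z' = {}"
    then have "(T \<union> Z) \<inter> (T \<union> Z') = T" by blast
    then show "T \<union> Z \<in> F \<longleftrightarrow> T \<union> Z' \<in> F"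
      using ZZ in_M TQ by (intro moved_same_side[OF F(1) finF ij(1)]) (auto simp: proper_def)
  qed (use that TQ R in \<open>auto simp: proper_def\<close>)
  have shape: "(\<exists>Z. proper Z \<and> C = T \<union> Z) \<or> (j \<notin> Q \<and> (\<exists>x\<in>T. x \<noteq> i \<and> C = T \<union> Q - {x}))" if C: "C \<in> ?M" for C
  proof -
    have Cd: "C \<in> hm_family T Q" "i \<in> C" "j \<notin> C" "insert j (C - {i}) \<notin> hm_family T Q"
      using C by (auto simp: moved_def G)
    have Cn: "C \<subseteq> {1..n}" "finite C" "card C = k" using Cd(1) by (auto simp: hm_family_def nsets_def)
    from TQ Cd(1) show ?thesis
    proof (cases rule: hm_family_cases)
      case 1
      have cZ: "card (C - T) = ?z" using 1 Cn fin TQ by (simp add: card_Diff_subset)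
      have "\<not> ?Q \<subseteq> C - T"
      proof
        assume sub: "?Q \<subseteq> C - T"
        then have "card ?Q \<le> card (C - T)" using Cn by (intro card_mono) auto
        then have jQ: "j \<in> Q" using cQ cZ by (auto split: if_splits)
        then have "?Q = C - T" using sub cQ cZ Cn card_subset_eq[of "C - T" ?Q] by simp
        then have "insert j (C - {i}) = T \<union> Q - {i}" using 1 jQ TQ loc by blast
        then show False using co_singleton_in_hm_family[OF TQ loc(1)] Cd by simp
      qed
      moreover have "C - T \<in> nsets ?R ?z" using Cn Cd cZ by (auto simp: nsets_def)
      moreover have "(C - T) \<inter> ?Q \<noteq> {}" using 1 TQ Cd by blast
      moreover have "C = T \<union> (C - T)" using 1 by blast
      ultimately show ?thesis unfolding proper_def by blast
    next
      case (2 x)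
      then have "j \<notin> Q" "x \<noteq> i" using Cd loc TQ by auto
      then show ?thesis using 2 by blast
    qed
  qed
  have link: "\<exists>Z. proper Z \<and> (C \<in> F \<longleftrightarrow> T \<union> Z \<in> F)" if C: "C \<in> ?M" for C
    using shape[OF C]
  proof
    assume "j \<notin> Q \<and> (\<exists>x\<in>T. x \<noteq> i \<and> C = T \<union> Q - {x})"
    then obtain x where x: "j \<notin> Q" "x \<in> T" "x \<noteq> i" "C = T \<union> Q - {x}" by blast
    have "Q \<noteq> {}" using TQ t_less_k by auto
    then obtain q where q: "q \<in> Q" by blast
    have QR: "Q \<subseteq> ?R" using TQ x by blast
    have "card (?R - (Q - {q})) = card ?R - ?z"
      using q QR fin TQ t_less_k by (subst card_Diff_subset) (auto simp: card_Diff_singleton)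
    then have "?z \<le> card (?R - (Q - {q}))" using R by linarith
    moreover have "{q} \<subseteq> ?R" "{q} \<inter> (Q - {q}) = {}" "card {q} \<le> ?z" using q QR t_less_k by auto
    ultimately obtain Z where Z: "Z \<in> nsets ?R ?z" "{q} \<subseteq> Z" "Z \<inter> (Q - {q}) = {}"
      using nsets_between[of ?R "{q}" "Q - {q}" ?z] by blast
    have "card (Q - {q}) \<noteq> 0" using q TQ fin t_less_k by (simp add: card_Diff_singleton)
    then have "Q - {q} \<noteq> {}" by (metis card.empty)
    then have "proper Z" using Z q x by (auto simp: proper_def)
    moreover have "C \<inter> (T \<union> Z) = insert q (T - {x})" using Z q x TQ by (auto simp: nsets_def)
    then have "card (C \<inter> (T \<union> Z)) = t" using fin x q TQ t_pos by (auto simp: card_insert_if card_Diff_singleton)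
    then have "C \<in> F \<longleftrightarrow> T \<union> Z \<in> F"
      using in_M[OF \<open>proper Z\<close>] C by (intro moved_same_side[OF F(1) finF ij(1)]) auto
    ultimately show ?thesis by blast
  qed blast
  show ?thesis using link[OF A] link[OF B] const by blast
qed

lemma extremal_unshift:
  assumes F: "t_intersecting t F" "F \<subseteq> nsets {1..n} k" and ij: "i \<noteq> j" "i \<in> {1..n}" "j \<in> {1..n}"
    and ext: "extremal (shift i j F)"
  shows "extremal F"
proof -
  have "finite F" using F(2) by (rule finite_subset) (auto simp: finite_imp_finite_nsets)
  moreover have "A \<in> F \<longleftrightarrow> B \<in> F"
    if A: "A \<in> moved i j (shift i j F)" and B: "B \<in> moved i j (shift i j F)" for A B
    using ext unfolding extremal_def
  proof (elim disjE exE conjE)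
    fix T Q assume TQ: "T \<union> Q \<subseteq> {1..n}" "T \<inter> Q = {}" "card T = t" "card Q = k + 1 - t"
      and G: "shift i j F = hm_family T Q"
    show ?thesis
      using moved_hm_location[OF TQ ij(1,3) A[unfolded G]]
        moved_hm_same_side_Q[OF F ij(1,3) TQ G _ _ A B] moved_hm_same_side_T[OF F ij(1,3) TQ G _ _ A B] by blast
  next
    fix Y assume "Y \<subseteq> {1..n}" "card Y = t + 2" "shift i j F = near_family Y"
    then show ?thesis using moved_near_same_side[OF F ij(1,3)] A B by blast
  qed
  ultimately consider "F = shift i j F" | "F = (`) (transpose i j) ` shift i j F"
    using unshift[of F i j] ij(1) by blast
  then show ?thesis
  proof cases
    case 1
    then show ?thesis using ext by simp
  next
    case 2
    have "extremal ((`) (transpose i j) ` shift i j F)"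
      by (intro extremal_image permutes_swap_id ij ext)
    then show ?thesis using 2 by simp
  qed
qed

end

section \<open>Sizes of the interpolating families\<close>

lemma card_trace:
  assumes "finite U" "V \<subseteq> U" "W \<subseteq> V" "card W \<le> k"
  shows "card {A \<in> nsets U k. A \<inter> V = W} = (card U - card V) choose (k - card W)"
proof -
  have fin: "finite V" using assms(1,2) by (rule rev_finite_subset)
  have "finite W" using fin assms(3) by (rule finite_subset[rotated])
  note fin = fin this
  have "bij_betw (\<lambda>B. W \<union> B) (nsets (U - V) (k - card W)) {A \<in> nsets U k. A \<inter> V = W}"
  proof (rule bij_betw_byWitness[where f' = "\<lambda>A. A - V"])
    show "\<forall>B\<in>nsets (U - V) (k - card W). (W \<union> B) - V = B" using assms by (auto simp: nsets_def)
    show "\<forall>A\<in>{A \<in> nsets U k. A \<inter> V = W}. W \<union> (A - V) = A" by blast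
    show "(\<lambda>B. W \<union> B) ` nsets (U - V) (k - card W) \<subseteq> {A \<in> nsets U k. A \<inter> V = W}"
    proof (clarify, intro conjI)
      fix B assume B: "B \<in> nsets (U - V) (k - card W)"
      then have "W \<inter> B = {}" using assms by (auto simp: nsets_def)
      then have "card (W \<union> B) = k" using B fin assms by (simp add: card_Un_disjoint nsets_def)
      then show "W \<union> B \<in> nsets U k" using B assms fin by (auto simp: nsets_def)
      show "(W \<union> B) \<inter> V = W" using B assms by (auto simp: nsets_def)
    qed
    show "(\<lambda>A. A - V) ` {A \<in> nsets U k. A \<inter> V = W} \<subseteq> nsets (U - V) (k - card W)"
    proof (rule image_subsetI)
      fix A assume "A \<in> {A \<in> nsets U k. A \<inter> V = W}"
      then have "card (A - V) = k - card W" "A \<subseteq> U" "finite A"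
        by (auto simp: card_Diff_subset_Int nsets_def)
      then show "A - V \<in> nsets (U - V) (k - card W)" by (auto simp: nsets_def)
    qed
  qed
  then have "card {A \<in> nsets U k. A \<inter> V = W} = card (nsets (U - V) (k - card W))"
    by (rule bij_betw_same_card[symmetric])
  also have "\<dots> = (card U - card V) choose (k - card W)"
    using assms fin by (simp add: card_nsets card_Diff_subset)
  finally show ?thesis .
qed

text \<open>This says that the quotient of \<open>N choose a\<close> by \<open>N choose b\<close> grows strictly when \<open>N\<close> and \<open>b\<close>
  decrease together; it gives the unimodality behind \<open>optimal_hm_family\<close>.\<close>
lemma binomial_ratio_strict:
  assumes "a + b < N"
  shows "(N choose b) * (Suc N choose a) < (N choose a) * (Suc N choose Suc b)"
proof -
  have p: "0 < N choose a" "0 < N choose b" using assms by auto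
  have 1: "Suc b * (Suc N choose Suc b) = Suc N * (N choose b)" by (rule Suc_times_binomial)
  have 2: "(Suc N - a) * (Suc N choose a) = Suc N * (N choose a)"
    using binomial_absorb_comp[of "Suc N" a] by simp
  have "Suc b < Suc N - a" using assms by linarith
  show ?thesis
  proof (rule ccontr)
    assume "\<not> ?thesis"
    then have le: "(N choose a) * (Suc N choose Suc b) \<le> (N choose b) * (Suc N choose a)" by simp
    have pos: "0 < (N choose a) * (Suc N choose Suc b)" using p assms by simp
    have "Suc b * (Suc N - a) * ((N choose a) * (Suc N choose Suc b))
        = (Suc N - a) * (N choose a) * (Suc N * (N choose b))" using 1 by (metis mult.assoc mult.commute)
    also have "\<dots> = (Suc N - a) * (N choose b) * (Suc N * (N choose a))" by (simp only: mult_ac)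
    also have "\<dots> = (Suc N - a) * (N choose b) * ((Suc N - a) * (Suc N choose a))" using 2 by simp
    also have "\<dots> = (Suc N - a) * (Suc N - a) * ((N choose b) * (Suc N choose a))" by (simp only: mult_ac)
    also have "\<dots> \<ge> (Suc N - a) * (Suc N - a) * ((N choose a) * (Suc N choose Suc b))"
      using le by (rule mult_left_mono) simp
    finally have "(Suc N - a) * (Suc N - a) \<le> Suc b * (Suc N - a)" using pos by simp
    then have "Suc N - a \<le> Suc b" using \<open>Suc b < Suc N - a\<close> by (metis mult_le_cancel2 not_less0 gr0I)
    then show False using \<open>Suc b < Suc N - a\<close> by simp
  qed
qed

context parameters
begin

lemma admissible_near_family:
  assumes Y: "Y \<subseteq> {1..n}" "card Y = t + 2"
  shows "admissible (near_family Y)"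
  unfolding admissible_def
proof (intro conjI allI impI)
  have finY: "finite Y" using Y finite_subset by auto
  show "near_family Y \<subseteq> nsets {1..n} k" by (auto simp: near_family_def)
  show "t_intersecting t (near_family Y)"
    unfolding t_intersecting_def
  proof (intro ballI)
    fix A B assume A: "A \<in> near_family Y" and B: "B \<in> near_family Y"
    have "card ((A \<inter> Y) \<union> (B \<inter> Y)) \<le> t + 2" using Y finY card_mono[of Y "(A \<inter> Y) \<union> (B \<inter> Y)"] by simp
    moreover have "card (A \<inter> Y) + card (B \<inter> Y) = card ((A \<inter> Y) \<union> (B \<inter> Y)) + card ((A \<inter> Y) \<inter> (B \<inter> Y))"
      using finY by (intro card_Un_Int) auto
    moreover have "t + 1 \<le> card (A \<inter> Y)" "t + 1 \<le> card (B \<inter> Y)" using A B by (auto simp: near_family_def)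
    ultimately have "t \<le> card ((A \<inter> Y) \<inter> (B \<inter> Y))" by linarith
    also have "\<dots> \<le> card (A \<inter> B)" using A nsetsD by (intro card_mono) (auto simp: near_family_def)
    finally show "t \<le> card (A \<inter> B)" .
  qed
  fix T :: "nat set" assume T: "card T = t"
  have "T \<noteq> {}" using T t_pos by auto
  then obtain x where x: "x \<in> T" by blast
  let ?Y = "Y - {x}"
  have "t + 1 \<le> card ?Y" using Y finY by (simp add: card_Diff_singleton_if)
  then obtain X where X: "X \<subseteq> ?Y" "card X = t + 1" using obtain_subset_with_card_n by metis
  have "card {1..n} - card {x} \<le> card ({1..n} - {x})" by (rule diff_card_le_card_Diff) simp
  then have "k \<le> card ({1..n} - {x})" using n_large t_less_k by simp
  then obtain A where "A \<in> nsets {1..n} k" "X \<subseteq> A" "A \<inter> {x} = {}"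
    using nsets_between[of "{1..n}" X "{x}" k] X Y t_less_k by auto
  moreover have "X \<subseteq> A \<inter> Y" using X calculation by blast
  then have "t + 1 \<le> card (A \<inter> Y)" using X(2) finY card_mono[of "A \<inter> Y" X] by simp
  ultimately show "\<not> (\<forall>A\<in>near_family Y. T \<subseteq> A)" using x by (auto simp: near_family_def)
qed

lemma admissible_hm_family:
  assumes TQ: "T \<union> Q \<subseteq> {1..n}" "T \<inter> Q = {}" "card T = t" and cQ: "2 \<le> card Q" "card Q \<le> k + 1 - t"
  shows "admissible (hm_family T Q)"
  unfolding admissible_def
proof (intro conjI allI impI)
  have fin: "finite T" "finite Q" using TQ finite_subset by auto
  have cTQ: "card (T \<union> Q) = t + card Q" using TQ fin by (simp add: card_Un_disjoint)
  show "hm_family T Q \<subseteq> nsets {1..n} k" by (auto simp: hm_family_def)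
  have cross: "t \<le> card (A \<inter> B)"
    if "A \<in> nsets {1..n} k" "T \<subseteq> A" "A \<inter> Q \<noteq> {}" "B \<inter> (T \<union> Q) = T \<union> Q - {x}" "x \<in> T" for A B x
  proof -
    obtain q where q: "q \<in> A" "q \<in> Q" using \<open>A \<inter> Q \<noteq> {}\<close> by blast
    have "insert q (T - {x}) \<subseteq> A \<inter> B" using that q TQ by blast
    moreover have "card (insert q (T - {x})) = t"
      using that q TQ fin t_pos by (auto simp: card_insert_if card_Diff_singleton)
    ultimately show ?thesis using nsetsD(1)[OF that(1)] card_mono[of "A \<inter> B" "insert q (T - {x})"] by auto
  qed
  show "t_intersecting t (hm_family T Q)"
    unfolding t_intersecting_def
  proof (intro ballI)
    fix A B assume A: "A \<in> hm_family T Q" and B: "B \<in> hm_family T Q"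
    have An: "A \<in> nsets {1..n} k" "B \<in> nsets {1..n} k" using A B by (auto simp: hm_family_def)
    have both: "t \<le> card (A \<inter> B)"
      if "A \<inter> (T \<union> Q) = T \<union> Q - {x}" "B \<inter> (T \<union> Q) = T \<union> Q - {y}" "x \<in> T" "y \<in> T" for x y
    proof -
      have "T \<union> Q - {x, y} \<subseteq> A \<inter> B" using that by blast
      then have "card (T \<union> Q - {x, y}) \<le> card (A \<inter> B)" using nsetsD(1)[OF An(1)] by (intro card_mono) auto
      moreover have "card (T \<union> Q) - card {x, y} \<le> card (T \<union> Q - {x, y})" by (rule diff_card_le_card_Diff) simp
      moreover have "card {x, y} \<le> 2" by (simp add: card_insert_if)
      ultimately show ?thesis using cTQ cQ by linarith
    qed
    have sub: "t \<le> card (A \<inter> B)" if "T \<subseteq> A" "T \<subseteq> B"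
      using that nsetsD(1)[OF An(1)] TQ(3) card_mono[of "A \<inter> B" T] by auto
    show "t \<le> card (A \<inter> B)"
    proof -
      let ?cut = "\<lambda>A. \<exists>x\<in>T. A \<inter> (T \<union> Q) = T \<union> Q - {x}"
      have "(T \<subseteq> A \<and> A \<inter> Q \<noteq> {}) \<or> ?cut A" "(T \<subseteq> B \<and> B \<inter> Q \<noteq> {}) \<or> ?cut B"
        using A B unfolding hm_family_def Un_iff mem_Collect_eq by (elim disjE conjE; simp)+
      then show ?thesis
      proof (elim disjE conjE bexE)
        assume "T \<subseteq> A" "T \<subseteq> B"
        then show ?thesis by (rule sub)
      next
        fix y assume "T \<subseteq> A" "A \<inter> Q \<noteq> {}" "B \<inter> (T \<union> Q) = T \<union> Q - {y}" "y \<in> T"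
        then show ?thesis by (rule cross[OF An(1)])
      next
        fix x assume "T \<subseteq> B" "B \<inter> Q \<noteq> {}" "A \<inter> (T \<union> Q) = T \<union> Q - {x}" "x \<in> T"
        then have "t \<le> card (B \<inter> A)" by (rule cross[OF An(2)])
        then show ?thesis by (simp add: Int_commute)
      next
        fix x y assume "A \<inter> (T \<union> Q) = T \<union> Q - {x}" "x \<in> T" "B \<inter> (T \<union> Q) = T \<union> Q - {y}" "y \<in> T"
        then show ?thesis using both by blast
      qed
    qed
  qed
  fix U :: "nat set" assume U: "card U = t"
  show "\<not> (\<forall>A\<in>hm_family T Q. U \<subseteq> A)"
  proof (cases "U \<subseteq> T")
    case True
    then have "U = T" using U TQ fin card_subset_eq by metis
    obtain x where x: "x \<in> T" using TQ t_pos by (metis card.empty ex_in_conv not_one_le_zero)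
    have c: "card (T \<union> Q - {x}) = t + card Q - 1" using cTQ x fin by (simp add: card_Diff_singleton)
    have "card ({1..n} - {x}) = n - 1" using TQ x by (subst card_Diff_singleton) auto
    then have "k \<le> card ({1..n} - {x})" using n_large t_less_k by linarith
    moreover have "T \<union> Q - {x} \<subseteq> {1..n}" using TQ(1) by blast
    moreover have "card (T \<union> Q - {x}) \<le> k" using c cQ t_less_k by linarith
    ultimately obtain A where A: "A \<in> nsets {1..n} k" "T \<union> Q - {x} \<subseteq> A" "A \<inter> {x} = {}"
      using nsets_between[of "{1..n}" "T \<union> Q - {x}" "{x}" k] by auto
    then have "A \<inter> (T \<union> Q) = T \<union> Q - {x}" by blast
    then have "A \<in> hm_family T Q" using A x by (auto simp: hm_family_def)
    then show ?thesis using A x \<open>U = T\<close> by blast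
  next
    case False
    then obtain v where v: "v \<in> U" "v \<notin> T" by blast
    have "\<not> Q \<subseteq> {v}" using cQ card_mono[of "{v}" Q] by auto
    then obtain q where q: "q \<in> Q" "q \<noteq> v" by blast
    have "card {1..n} - card {v} \<le> card ({1..n} - {v})" by (rule diff_card_le_card_Diff) simp
    then have "k \<le> card ({1..n} - {v})" using n_large t_less_k by simp
    moreover have "card (insert q T) \<le> k" using TQ fin t_less_k by (simp add: card_insert_if)
    moreover have "insert q T \<subseteq> {1..n}" "insert q T \<inter> {v} = {}" using TQ q v by blast+
    ultimately obtain A where A: "A \<in> nsets {1..n} k" "insert q T \<subseteq> A" "A \<inter> {v} = {}"
      using nsets_between[of "{1..n}" "insert q T" "{v}" k] by auto
    then have "A \<in> hm_family T Q" using q by (auto simp: hm_family_def)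
    then show ?thesis using A v by blast
  qed
qed

text \<open>Both sides count the \<open>k\<close>-sets containing \<open>T\<close> together with those that omit exactly one
  element of \<open>T \<union> Q\<close>, lying in \<open>T\<close>; the second summand on the left stands for the sets that contain \<open>T\<close> and avoid \<open>Q\<close>.\<close>
lemma card_hm_family:
  assumes TQ: "T \<union> Q \<subseteq> {1..n}" "T \<inter> Q = {}" "card T = t" "card (T \<union> Q) = m" and m: "m \<le> k + 1"
  shows "card (hm_family T Q) + (n - m choose (k - t)) = (n - t choose (k - t)) + t * (n - m choose (k + 1 - m))"
proof -
  have fin: "finite T" "finite Q" using TQ finite_subset by auto
  let ?S = "nsets {1..n} k"
  have finS: "finite ?S" by (simp add: finite_imp_finite_nsets)
  let ?A = "{A \<in> ?S. T \<subseteq> A \<and> A \<inter> Q \<noteq> {}}"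
  let ?C = "\<lambda>x. {A \<in> ?S. A \<inter> (T \<union> Q) = T \<union> Q - {x}}"
  have "card {A \<in> ?S. A \<inter> T = T} = (n - t choose (k - t))"
    using card_trace[of "{1..n}" T T k] TQ t_less_k by simp
  moreover have "card {A \<in> ?S. A \<inter> (T \<union> Q) = T} = (n - m choose (k - t))"
    using card_trace[of "{1..n}" "T \<union> Q" T k] TQ t_less_k by simp
  moreover have "{A \<in> ?S. A \<inter> T = T} = ?A \<union> {A \<in> ?S. A \<inter> (T \<union> Q) = T}" using TQ by blast
  moreover have "?A \<inter> {A \<in> ?S. A \<inter> (T \<union> Q) = T} = {}" using TQ by blast
  ultimately have cA: "card ?A + (n - m choose (k - t)) = (n - t choose (k - t))"
    using finS by (metis (no_types, lifting) card_Un_disjoint finite_Un finite_subset mem_Collect_eq subsetI)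
  have cC: "card (?C x) = (n - m choose (k + 1 - m))" if "x \<in> T" for x
  proof -
    have cx: "card (T \<union> Q - {x}) = m - 1" using that TQ fin by (simp add: card_Diff_singleton)
    have "m \<noteq> 0" using that TQ fin by auto
    moreover have "card (?C x) = (n - m) choose (k - (m - 1))"
      using card_trace[of "{1..n}" "T \<union> Q" "T \<union> Q - {x}" k] TQ m cx by auto
    ultimately show ?thesis using m by (simp add: Suc_diff_le)
  qed
  have "card (\<Union>x\<in>T. ?C x) = (\<Sum>x\<in>T. card (?C x))"
    using fin finS by (intro card_UN_disjoint) auto
  then have cU: "card (\<Union>x\<in>T. ?C x) = t * (n - m choose (k + 1 - m))" using cC TQ by simp
  have "hm_family T Q = ?A \<union> (\<Union>x\<in>T. ?C x)" by (auto simp: hm_family_def)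
  moreover have "?A \<inter> (\<Union>x\<in>T. ?C x) = {}" by blast
  ultimately have "card (hm_family T Q) = card ?A + card (\<Union>x\<in>T. ?C x)"
    using finS fin by (simp add: card_Un_disjoint)
  then show ?thesis using cA cU by simp
qed

text \<open>If \<open>|Q|\<close> were not maximal, both neighbours of \<open>hm_family T Q\<close> in the chain would be at most as
  large.  The two resulting inequalities between \<open>N choose a\<close> and \<open>t * (N choose b)\<close> contradict the strict
  growth of the quotient, so an interior member of the chain is never largest.\<close>
lemma optimal_hm_family:
  assumes opt: "optimal (hm_family T Q)" and TQ: "T \<union> Q \<subseteq> {1..n}" "T \<inter> Q = {}" "card T = t"
    and cQ: "3 \<le> card Q" "card Q \<le> k + 1 - t"
  shows "card Q = k + 1 - t"
proof (rule ccontr)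
  assume "card Q \<noteq> k + 1 - t"
  have fin: "finite T" "finite Q" using TQ finite_subset by auto
  define m where "m = card (T \<union> Q)"
  have m: "m = t + card Q" using TQ fin by (simp add: m_def card_Un_disjoint)
  then have mk: "m \<le> k" "t + 3 \<le> m" using cQ \<open>card Q \<noteq> k + 1 - t\<close> t_less_k by auto
  have "\<not> {1..n} \<subseteq> T \<union> Q"
  proof
    assume "{1..n} \<subseteq> T \<union> Q"
    then have "n \<le> m" using fin card_mono[of "T \<union> Q" "{1..n}"] by (simp add: m_def)
    then show False using mk n_large t_less_k by linarith
  qed
  then obtain v where v: "v \<in> {1..n}" "v \<notin> T" "v \<notin> Q" by blast
  have "Q \<noteq> {}" using cQ by auto
  then obtain q where q: "q \<in> Q" by blast
  have up: "card (hm_family T (insert v Q)) \<le> card (hm_family T Q)"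
  proof -
    have "admissible (hm_family T (insert v Q))"
    proof (rule admissible_hm_family)
      show "T \<union> insert v Q \<subseteq> {1..n}" "T \<inter> insert v Q = {}" using TQ v by blast+
      show "2 \<le> card (insert v Q)" "card (insert v Q) \<le> k + 1 - t" using v fin cQ mk m by simp_all
    qed (rule TQ(3))
    then show ?thesis using opt by (auto simp: optimal_def)
  qed
  have down: "card (hm_family T (Q - {q})) \<le> card (hm_family T Q)"
  proof -
    have "admissible (hm_family T (Q - {q}))"
    proof (rule admissible_hm_family)
      show "T \<union> (Q - {q}) \<subseteq> {1..n}" "T \<inter> (Q - {q}) = {}" using TQ by blast+
      show "2 \<le> card (Q - {q})" "card (Q - {q}) \<le> k + 1 - t"
        using q fin cQ by (simp_all add: card_Diff_singleton)
    qed (rule TQ(3))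
    then show ?thesis using opt by (auto simp: optimal_def)
  qed
  have "T \<union> insert v Q = insert v (T \<union> Q)" by blast
  then have cu: "card (T \<union> insert v Q) = m + 1" using v fin by (simp add: m_def)
  have "T \<union> (Q - {q}) = T \<union> Q - {q}" using q TQ by blast
  then have cd: "card (T \<union> (Q - {q})) = m - 1" using q fin by (simp add: m_def card_Diff_singleton)
  \<comment> \<open>The size grows by \<open>(N choose a) - t (N choose b)\<close> from \<open>m\<close> to \<open>m + 1\<close>; for the step from \<open>m - 1\<close> to \<open>m\<close> replace \<open>N\<close>, \<open>b\<close> by \<open>N + 1\<close>, \<open>b + 1\<close>.\<close>
  define N where "N = n - m - 1"
  have N: "n - m = Suc N" "n - (m - 1) = Suc (Suc N)" "n - (m + 1) = N"
    using mk n_large t_less_k by (auto simp: N_def)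
  define a where "a = k - t - 1"
  define b where "b = k - m + 1"
  have ab: "k - t = Suc a" "k + 1 - m = b" "k + 1 - (m - 1) = Suc b" "k + 1 - (m + 1) = b - 1" "b = Suc (b - 1)"
    using mk t_less_k by (auto simp: a_def b_def)
  have 0: "card (hm_family T Q) + (Suc N choose Suc a) = (n - t choose Suc a) + t * (Suc N choose b)"
    using card_hm_family[of T Q m] TQ mk N ab by (simp add: m_def)
  have 1: "card (hm_family T (insert v Q)) + (N choose Suc a) = (n - t choose Suc a) + t * (N choose (b - 1))"
    using card_hm_family[of T "insert v Q" "m + 1"] TQ v cu mk N ab by simp
  have 2: "card (hm_family T (Q - {q})) + (Suc (Suc N) choose Suc a) = (n - t choose Suc a) + t * (Suc (Suc N) choose Suc b)"
  proof -
    have "T \<union> (Q - {q}) \<subseteq> {1..n}" "T \<inter> (Q - {q}) = {}" using TQ by blast+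
    from card_hm_family[OF this TQ(3) cd] show ?thesis using mk N ab by simp
  qed
  have "Suc N choose b = (N choose b) + (N choose (b - 1))" using ab(5) by (metis binomial_Suc_Suc add.commute)
  then have le1: "(N choose a) \<le> t * (N choose b)" using up 0 1 by (simp add: algebra_simps)
  have le2: "t * (Suc N choose Suc b) \<le> (Suc N choose a)" using down 0 2 by (simp add: algebra_simps)
  have "(N choose a) * (t * (Suc N choose Suc b)) \<le> t * (N choose b) * (Suc N choose a)"
    using le1 le2 by (intro mult_mono) auto
  then have "t * ((N choose a) * (Suc N choose Suc b)) \<le> t * ((N choose b) * (Suc N choose a))"
    by (simp only: mult_ac)
  then have "(N choose a) * (Suc N choose Suc b) \<le> (N choose b) * (Suc N choose a)" using t_pos by simp
  moreover have "a + b < N" using mk n_large t_less_k by (simp add: a_def b_def N_def)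
  ultimately show False using binomial_ratio_strict[of a b N] by simp
qed

end

section \<open>Traces and pulling\<close>

text \<open>The exchanges are restricted to \<open>j \<ge> t + 2\<close>, which leaves \<open>t\<close> and \<open>t + 1\<close> on an equal footing;
  this covers both the fully shifted families and those whose members all contain \<open>{1..t-1}\<close> and meet
  \<open>{t, t+1}\<close>.  The sets in \<open>co_t\<close> and \<open>co_t1\<close> witness nontriviality.\<close>
locale nearly_shifted = parameters +
  fixes F :: "nat set set" and m :: nat
  assumes opt: "optimal F"
    and exchange: "\<And>A i j. A \<in> F \<Longrightarrow> j \<in> A \<Longrightarrow> i \<notin> A \<Longrightarrow> 1 \<le> i \<Longrightarrow> i < j \<Longrightarrow> t + 2 \<le> j \<Longrightarrow> insert i (A - {j}) \<in> F"
    and co_t: "{1..k+1} - {t} \<in> F" and co_t1: "{1..k+1} - {t+1} \<in> F"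
    and m_range: "t + 2 \<le> m" "m \<le> n"
    and determined: "\<And>A B. A \<in> F \<Longrightarrow> B \<in> nsets {1..n} k \<Longrightarrow> A \<inter> {1..m} = B \<inter> {1..m} \<Longrightarrow> B \<in> F"
begin

definition traces :: "nat set set" where
  "traces = (\<lambda>A. A \<inter> {1..m}) ` F"

text \<open>The traces that really use \<open>m\<close>.  They take the place of the members with last element \<open>m\<close> of a
  generating set in the sense of Ahlswede and Khachatrian.\<close>
definition pivotal :: "nat set set" where
  "pivotal = {E \<in> traces. m \<in> E \<and> E - {m} \<notin> traces}"

lemma F_nsets: "F \<subseteq> nsets {1..n} k" and F_int: "t_intersecting t F"
  using opt by (auto simp: optimal_def admissible_def)

lemma F_D:
  assumes "A \<in> F"
  shows "finite A" "A \<subseteq> {1..n}" "card A = k"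
  using nsetsD F_nsets assms by blast+

lemma tracesD:
  assumes "E \<in> traces"
  shows "E \<subseteq> {1..m}" "finite E" "card E \<le> k"
proof -
  obtain A where A: "A \<in> F" "E = A \<inter> {1..m}" using assms by (auto simp: traces_def)
  show "E \<subseteq> {1..m}" "finite E" using A by auto
  show "card E \<le> k" using A F_D[OF A(1)] card_mono[of A E] by auto
qed

lemma finite_traces: "finite traces"
  by (rule finite_subset[of _ "Pow {1..m}"]) (use tracesD in auto)

lemma F_eq_traces: "F = {A \<in> nsets {1..n} k. A \<inter> {1..m} \<in> traces}"
  using F_nsets determined by (auto simp: traces_def)

lemma exchange_trace:
  assumes E: "E \<in> traces" "j \<in> E" "i \<notin> E" "1 \<le> i" "i < j" "t + 2 \<le> j"
  shows "insert i (E - {j}) \<in> traces"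
proof -
  obtain A where A: "A \<in> F" "E = A \<inter> {1..m}" using E by (auto simp: traces_def)
  then have "j \<le> m" using E by auto
  then have "i \<notin> A" using A E by auto
  then have "insert i (A - {j}) \<in> F" using exchange A E by auto
  moreover have "insert i (A - {j}) \<inter> {1..m} = insert i (E - {j})"
    using A E \<open>j \<le> m\<close> by auto
  ultimately show ?thesis unfolding traces_def by (metis imageI)
qed

text \<open>Common elements of two members beyond \<open>m\<close> can be exchanged one by one for elements outside both
  members, which exist because two members cover fewer than \<open>n\<close> points.  The trace of the
  intersection is unchanged, and in the end it is the whole intersection.\<close>
lemma traces_intersect:
  assumes "D \<in> traces" "E \<in> traces"
  shows "t \<le> card (D \<inter> E)"
proof -
  have "t \<le> card (A \<inter> B \<inter> {1..m})" if "A \<in> F" "B \<in> F" for A B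
    using that
  proof (induction "card (A \<inter> B - {1..m})" arbitrary: A rule: less_induct)
    case less
    note AB = F_D[OF less.prems(1)] F_D[OF less.prems(2)]
    show ?case
    proof (cases "A \<inter> B - {1..m} = {}")
      case True
      then have "A \<inter> B \<inter> {1..m} = A \<inter> B" by blast
      then show ?thesis using F_int less.prems by (auto simp: t_intersecting_def)
    next
      case False
      then obtain j where j: "j \<in> A" "j \<in> B" "j \<notin> {1..m}" by blast
      have "t \<le> card (A \<inter> B)" using F_int less.prems by (auto simp: t_intersecting_def)
      moreover have "card A + card B = card (A \<union> B) + card (A \<inter> B)" using AB by (intro card_Un_Int) auto
      ultimately have "card (A \<union> B) < n" using AB n_large by linarith
      then have "\<not> {1..n} \<subseteq> A \<union> B" using AB card_mono[of "A \<union> B" "{1..n}"] by auto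
      then obtain y where y: "y \<in> {1..n}" "y \<notin> A" "y \<notin> B" by blast
      let ?A = "insert y (A - {j})"
      have A': "?A \<in> F"
      proof (cases "y < j")
        case True
        then show ?thesis using exchange[OF less.prems(1) j(1) y(2)] y j AB m_range by auto
      next
        case False
        then have "j < y" using j y by (metis linorder_neqE_nat)
        moreover have "m < j" using j AB by auto
        ultimately have "A \<inter> {1..m} = ?A \<inter> {1..m}" by auto
        moreover have "?A \<in> nsets {1..n} k"
          using exchange_in_nsets[of A "{1..n}" k j y] F_nsets less.prems j y by auto
        ultimately show ?thesis using determined less.prems by blast
      qed
      have eq: "?A \<inter> B = A \<inter> B - {j}" using y by blast
      have "card (?A \<inter> B - {1..m}) < card (A \<inter> B - {1..m})"
        unfolding eq using j AB by (intro psubset_card_mono) auto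
      then have "t \<le> card (?A \<inter> B \<inter> {1..m})" using less.hyps A' less.prems by blast
      moreover have "?A \<inter> B \<inter> {1..m} = A \<inter> B \<inter> {1..m}" unfolding eq using j by blast
      ultimately show ?thesis by simp
    qed
  qed
  moreover obtain A B where "A \<in> F" "D = A \<inter> {1..m}" "B \<in> F" "E = B \<inter> {1..m}"
    using assms by (auto simp: traces_def)
  moreover have "D \<inter> E = A \<inter> B \<inter> {1..m}" using calculation by blast
  ultimately show ?thesis by simp
qed

text \<open>An element \<open>l\<close> in neither trace could replace \<open>m\<close> in \<open>D\<close>, and the new trace would meet \<open>E\<close> in
  only \<open>t - 1\<close> elements.\<close>
lemma conflict_covers:
  assumes D: "D \<in> traces" "m \<in> D" and E: "E \<in> traces" "m \<in> E" and c: "card (D \<inter> E) = t"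
  shows "D \<union> E = {1..m}" "card D + card E = m + t"
proof -
  show U: "D \<union> E = {1..m}"
  proof (rule ccontr)
    assume "D \<union> E \<noteq> {1..m}"
    then obtain l where l: "l \<in> {1..m}" "l \<notin> D" "l \<notin> E" using tracesD[OF D(1)] tracesD[OF E(1)] by blast
    then have "l < m" using D by (metis atLeastAtMost_iff le_neq_implies_less)
    then have "insert l (D - {m}) \<in> traces" using exchange_trace D l m_range by auto
    then have "t \<le> card (insert l (D - {m}) \<inter> E)" using traces_intersect E by blast
    moreover have "insert l (D - {m}) \<inter> E = D \<inter> E - {m}" using l by blast
    moreover have "card (D \<inter> E - {m}) < card (D \<inter> E)"
      using D E tracesD[OF D(1)] by (intro card_Diff1_less) auto
    ultimately show False using c by simp
  qed
  have "card D + card E = card (D \<union> E) + card (D \<inter> E)" using tracesD[OF D(1)] tracesD[OF E(1)] by (intro card_Un_Int) auto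
  then show "card D + card E = m + t" using U c by simp
qed

lemma card_lift:
  assumes "X \<subseteq> Pow {1..m}" "\<And>E. E \<in> X \<Longrightarrow> card E \<le> k"
  shows "card {A \<in> nsets {1..n} k. A \<inter> {1..m} \<in> X} = (\<Sum>E\<in>X. n - m choose (k - card E))"
proof -
  have finX: "finite X" using assms(1) by (rule finite_subset) simp
  have "{A \<in> nsets {1..n} k. A \<inter> {1..m} \<in> X} = (\<Union>E\<in>X. {A \<in> nsets {1..n} k. A \<inter> {1..m} = E})" by blast
  also have "card \<dots> = (\<Sum>E\<in>X. card {A \<in> nsets {1..n} k. A \<inter> {1..m} = E})"
    using finX by (intro card_UN_disjoint) (auto simp: finite_imp_finite_nsets)
  also have "\<dots> = (\<Sum>E\<in>X. n - m choose (k - card E))"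
    using assms m_range by (intro sum.cong refl) (subst card_trace, auto)
  finally show ?thesis .
qed

lemma co_trace:
  assumes "t \<le> x" "x \<le> k + 1"
  shows "{1..k+1} - {x} \<in> F"
proof -
  consider "x = t" | "x = t + 1" | "t + 2 \<le> x" using assms by linarith
  then show ?thesis
  proof cases
    case 3
    then have "insert t ({1..k+1} - {t} - {x}) \<in> F"
      using assms t_pos by (intro exchange[OF co_t]) auto
    moreover have "insert t ({1..k+1} - {t} - {x}) = {1..k+1} - {x}" using 3 t_pos assms by auto
    ultimately show ?thesis by simp
  qed (use co_t co_t1 in simp_all)
qed

text \<open>Deleting the traces in \<open>D\<close> and adding \<open>E - {m}\<close> for \<open>E\<close> in \<open>S\<close> gives another admissible family,
  which cannot be larger than \<open>F\<close>.  An added set can only conflict with pivotal traces: if \<open>G\<close>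
  contains \<open>m\<close> and is not pivotal, then \<open>G - {m}\<close> is a trace too and meets \<open>E\<close> in \<open>t\<close> elements.
  The new family has no common \<open>t\<close>-set because all \<open>{1..k+1} - {x}\<close> with \<open>x \<ge> t\<close> survive, and these
  have only \<open>{1..t-1}\<close> in common.\<close>
lemma pull:
  assumes S: "S \<subseteq> pivotal" and D: "D \<subseteq> pivotal" and SD: "S \<inter> D = {}"
    and conflict: "\<And>E G. E \<in> S \<Longrightarrow> G \<in> pivotal \<Longrightarrow> card (E \<inter> G) = t \<Longrightarrow> G \<in> D"
    and keep: "\<And>x. t \<le> x \<Longrightarrow> x \<le> k + 1 \<Longrightarrow> ({1..k+1} - {x}) \<inter> {1..m} \<notin> D"
  shows "(\<Sum>E\<in>S. n - m choose (k + 1 - card E)) \<le> (\<Sum>E\<in>D. n - m choose (k - card E))"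
proof -
  let ?P = "(\<lambda>E. E - {m}) ` S"
  define T' where "T' = (traces - D) \<union> ?P"
  let ?F = "{A \<in> nsets {1..n} k. A \<inter> {1..m} \<in> T'}"
  have "S \<subseteq> traces" "D \<subseteq> traces" using S D by (auto simp: pivotal_def)
  then have fin: "finite S" "finite D" using finite_subset finite_traces by blast+
  have Str: "E \<in> traces" "m \<in> E" "E - {m} \<notin> traces" if "E \<in> S" for E using that S by (auto simp: pivotal_def)
  have pulled: "t \<le> card ((E - {m}) \<inter> G)" if E: "E \<in> S" and G: "G \<in> traces - D" for E G
  proof (cases "m \<in> G")
    case False
    then have "(E - {m}) \<inter> G = E \<inter> G" by blast
    then show ?thesis using traces_intersect[of E G] Str E G by auto
  next
    case True
    have e: "(E - {m}) \<inter> G = E \<inter> G - {m}" "E \<inter> (G - {m}) = E \<inter> G - {m}" by blast+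
    show ?thesis
    proof (cases "G \<in> pivotal")
      case False
      then have "G - {m} \<in> traces" using G True by (auto simp: pivotal_def)
      then show ?thesis using traces_intersect[of E "G - {m}"] Str E e by auto
    next
      case piv: True
      then have "card (E \<inter> G) \<noteq> t" using conflict[OF E] G by blast
      then have "t + 1 \<le> card (E \<inter> G)" using traces_intersect[of E G] Str E G by force
      then show ?thesis using Str E True tracesD[of E] e by (simp add: card_Diff_singleton)
    qed
  qed
  have pulled2: "t \<le> card ((E - {m}) \<inter> (G - {m}))" if E: "E \<in> S" and G: "G \<in> S" for E G
  proof -
    have "G \<notin> D" using G SD by blast
    then have "t \<le> card ((E - {m}) \<inter> G)" using pulled E G Str by blast
    moreover have "(E - {m}) \<inter> (G - {m}) = (E - {m}) \<inter> G" by blast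
    ultimately show ?thesis by simp
  qed
  have T'_int: "t \<le> card (E \<inter> G)" if "E \<in> T'" "G \<in> T'" for E G
    using that traces_intersect pulled pulled2 unfolding T'_def by (auto simp: Int_commute)
  have adm: "admissible ?F"
    unfolding admissible_def
  proof (intro conjI allI impI)
    show "t_intersecting t ?F" unfolding t_intersecting_def
    proof (intro ballI)
      fix A B assume AB: "A \<in> ?F" "B \<in> ?F"
      then have "t \<le> card ((A \<inter> {1..m}) \<inter> (B \<inter> {1..m}))" using T'_int by blast
      also have "\<dots> \<le> card (A \<inter> B)" using AB nsetsD by (intro card_mono) auto
      finally show "t \<le> card (A \<inter> B)" .
    qed
    fix U :: "nat set" assume U: "card U = t"
    show "\<not> (\<forall>A\<in>?F. U \<subseteq> A)"
    proof
      assume all: "\<forall>A\<in>?F. U \<subseteq> A"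
      have co: "U \<subseteq> {1..k+1} - {x}" if "t \<le> x" "x \<le> k + 1" for x
      proof -
        have "{1..k+1} - {x} \<in> F" using co_trace that .
        then have "{1..k+1} - {x} \<in> ?F" using F_nsets keep[OF that] by (auto simp: T'_def traces_def)
        then show ?thesis using all by blast
      qed
      have "U \<subseteq> {1..t-1}"
      proof
        fix u assume "u \<in> U"
        then have "u \<in> {1..k+1} - {t}" using co[of t] t_less_k by auto
        moreover have "\<not> t \<le> u" using co[of u] \<open>u \<in> U\<close> calculation by auto
        ultimately show "u \<in> {1..t-1}" by auto
      qed
      then have "card U \<le> t - 1" using card_mono[of "{1..t-1}" U] by simp
      then show False using U t_pos by simp
    qed
  qed auto
  have sub: "T' \<subseteq> Pow {1..m}" "\<And>E. E \<in> T' \<Longrightarrow> card E \<le> k"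
  proof -
    show "T' \<subseteq> Pow {1..m}" using tracesD(1) S by (auto simp: T'_def pivotal_def)
    show "card E \<le> k" if "E \<in> T'" for E
      using that tracesD(3) Str tracesD(2) card_Diff1_le[of _ m] le_trans unfolding T'_def by blast
  qed
  have injm: "inj_on (\<lambda>E. E - {m}) S" using Str by (intro inj_onI) (metis insert_Diff)
  have "card ?F = (\<Sum>E\<in>T'. n - m choose (k - card E))" using card_lift[OF sub] .
  also have "\<dots> = (\<Sum>E\<in>traces - D. n - m choose (k - card E)) + (\<Sum>E\<in>?P. n - m choose (k - card E))"
    unfolding T'_def using finite_traces fin Str by (intro sum.union_disjoint) auto
  also have "(\<Sum>E\<in>?P. n - m choose (k - card E)) = (\<Sum>E\<in>S. n - m choose (k - card (E - {m})))"
    by (simp add: sum.reindex[OF injm])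
  also have "\<dots> = (\<Sum>E\<in>S. n - m choose (k + 1 - card E))"
  proof (intro sum.cong refl)
    fix E assume "E \<in> S"
    then have "card (E - {m}) = card E - 1" "card E \<noteq> 0"
      using Str tracesD[of E] by (auto simp: card_Diff_singleton)
    then show "n - m choose (k - card (E - {m})) = n - m choose (k + 1 - card E)" by simp
  qed
  finally have cF': "card ?F = (\<Sum>E\<in>traces - D. n - m choose (k - card E)) + (\<Sum>E\<in>S. n - m choose (k + 1 - card E))" .
  have "card F = (\<Sum>E\<in>traces. n - m choose (k - card E))"
    using card_lift[of traces] tracesD F_eq_traces by auto
  also have "\<dots> = (\<Sum>E\<in>traces - D. n - m choose (k - card E)) + (\<Sum>E\<in>D. n - m choose (k - card E))"
    using D finite_traces by (intro sum.subset_diff) (auto simp: pivotal_def)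
  finally have cF: "card F = (\<Sum>E\<in>traces - D. n - m choose (k - card E)) + (\<Sum>E\<in>D. n - m choose (k - card E))" .
  have "card ?F \<le> card F" using opt adm by (auto simp: optimal_def)
  then show ?thesis using cF cF' by simp
qed

text \<open>A trace of size at most \<open>t\<close> has to lie inside every \<open>{1..m} - {x}\<close> with \<open>x \<ge> t\<close>, since it meets
  each in \<open>t\<close> elements; then it fits into \<open>{1..t-1}\<close>.\<close>
lemma large_traces:
  assumes E: "E \<in> traces" and m: "m \<le> k + 1"
  shows "t + 1 \<le> card E"
proof (rule ccontr)
  assume not: "\<not> t + 1 \<le> card E"
  note Ed = tracesD[OF E]
  have co: "t \<le> card (D \<inter> ({1..m} - {x}))" if "t \<le> x" "x \<le> k + 1" "D \<in> traces" for x D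
  proof -
    have "({1..k+1} - {x}) \<inter> {1..m} \<in> traces" using co_trace[OF that(1,2)] by (auto simp: traces_def)
    moreover have "({1..k+1} - {x}) \<inter> {1..m} = {1..m} - {x}" using m by auto
    ultimately show ?thesis using traces_intersect that by metis
  qed
  have small: "x \<notin> D" if "t \<le> x" "x \<le> k + 1" "D \<in> traces" "card D \<le> t" for x D
  proof
    assume "x \<in> D"
    then have "card (D \<inter> ({1..m} - {x})) < card D"
      using tracesD[OF that(3)] by (intro psubset_card_mono) auto
    then show False using co[OF that(1-3)] that(4) by simp
  qed
  have cE: "card E = t" using co[OF _ _ E, of t] card_mono[OF Ed(2), of "E \<inter> ({1..m} - {t})"] t_less_k
      not by auto
  have "E \<subseteq> {1..t-1}"
  proof
    fix u assume "u \<in> E"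
    then have "u \<in> {1..m}" "\<not> t \<le> u" using Ed small[OF _ _ E, of u] cE m by auto
    then show "u \<in> {1..t-1}" by auto
  qed
  then have "card E \<le> t - 1" using card_mono[of "{1..t-1}" E] by simp
  then show False using cE t_pos by simp
qed

text \<open>Otherwise \<open>E - {m}\<close> could be added at no cost.  The assumption on \<open>n - m\<close> says that there are
  \<open>k\<close>-sets with this trace.\<close>
lemma pivotal_partner:
  assumes E: "E \<in> pivotal" and room: "k + 1 - card E \<le> n - m"
  shows "\<exists>G\<in>pivotal. card (E \<inter> G) = t"
proof (rule ccontr)
  assume neg: "\<not> (\<exists>G\<in>pivotal. card (E \<inter> G) = t)"
  then have none: "card (E \<inter> G) \<noteq> t" if "G \<in> pivotal" for G using that by blast
  have "(\<Sum>E\<in>{E}. n - m choose (k + 1 - card E)) \<le> (\<Sum>E\<in>({} :: nat set set). n - m choose (k - card E))"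
    by (rule pull) (use E none in auto)
  moreover have "0 < n - m choose (k + 1 - card E)" using room by simp
  ultimately show False by simp
qed

end

section \<open>Classification of nearly shifted families\<close>

lemma Suc_times_binomial_Suc: "Suc a * (N choose Suc a) = (N - a) * (N choose a)"
  by (metis binomial_absorb_comp binomial_absorption)

lemma binomial_product_strict:
  assumes "a + b + 2 \<le> N"
  shows "(N choose a) * (N choose b) < (N choose Suc a) * (N choose Suc b)"
proof -
  let ?x = "(N choose a) * (N choose b)" and ?y = "(N choose Suc a) * (N choose Suc b)"
  have x: "0 < ?x" using assms by simp
  have "Suc a * Suc b * ?y = (Suc a * (N choose Suc a)) * (Suc b * (N choose Suc b))" by (simp only: mult_ac)
  also have "\<dots> = (N - a) * (N - b) * ?x" by (simp only: Suc_times_binomial_Suc mult_ac)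
  finally have e: "Suc a * Suc b * ?y = (N - a) * (N - b) * ?x" .
  have "Suc b * Suc a < (N - a) * (N - b)"
    using assms by (intro mult_strict_mono) auto
  then have "Suc a * Suc b * ?x < (N - a) * (N - b) * ?x" using x by (simp only: mult.commute[of "Suc b"] mult_less_cancel2)
  then have "Suc a * Suc b * ?x < Suc a * Suc b * ?y" using e by simp
  then show ?thesis by (simp only: mult_less_cancel1)
qed

text \<open>With \<open>K = k + 1 - t\<close> the inequality reads \<open>c n \<le> (2c + t - 1) K\<close>.  Together with \<open>2n > (t + 3) K\<close> it
  would give \<open>(c - 2)(t - 1) < 0\<close>; so \<open>c = 2\<close> is the tight case and explains the bound on \<open>n\<close>.\<close>
lemma (in parameters) averaging_numbers:
  assumes c: "2 \<le> c" and tc: "t + c \<le> k" and le: "c * (n - k - c) \<le> (t + c - 1) * (k - t - c + 1)"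
  shows False
proof -
  define K where "K = int k + 1 - int t"
  have K: "3 \<le> K" using t_less_k by (simp add: K_def)
  have "k + c \<le> n" using tc n_large by linarith
  then have "int (n - k - c) = int n - K - int t + 1 - int c" by (simp add: K_def)
  moreover have "int (t + c - 1) = int t + int c - 1" using c by simp
  moreover have "int (k - t - c + 1) = K - int c" using tc by (simp add: K_def)
  moreover have "int (c * (n - k - c)) \<le> int ((t + c - 1) * (k - t - c + 1))" using le by (simp only: of_nat_le_iff)
  ultimately have "int c * (int n - K - int t + 1 - int c) \<le> (int t + int c - 1) * (K - int c)"
    by (simp only: of_nat_mult)
  then have 1: "int c * int n \<le> (2 * int c + int t - 1) * K" by (simp add: algebra_simps)
  have "int ((t + 3) * (k + 1 - t)) < int (2 * n)" using n_bound by (simp only: of_nat_less_iff)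
  moreover have "int (k + 1 - t) = K" using t_less_k by (simp add: K_def)
  ultimately have "(int t + 3) * K < 2 * int n" by (simp only: of_nat_mult of_nat_add of_nat_numeral)
  then have "int c * ((int t + 3) * K) < int c * (2 * int n)" using c by (intro mult_strict_left_mono) auto
  then have "(int c * (int t + 3)) * K < (2 * (2 * int c + int t - 1)) * K" using 1 by (simp add: algebra_simps)
  then have "int c * (int t + 3) < 2 * (2 * int c + int t - 1)" using K by (simp add: mult_less_cancel_right)
  then have "(int c - 2) * (int t - 1) < 0" by (simp add: algebra_simps)
  moreover have "0 \<le> (int c - 2) * (int t - 1)" using c t_pos by (intro mult_nonneg_nonneg) auto
  ultimately show False by simp
qed

context nearly_shifted
begin

lemma conflict_sizes:
  assumes "E \<in> pivotal" "G \<in> pivotal" "card (E \<inter> G) = t"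
  shows "E \<union> G = {1..m}" "card E + card G = m + t"
  using conflict_covers[of E G] assms by (auto simp: pivotal_def)

lemma finite_pivotal: "finite pivotal"
  using finite_traces by (auto simp: pivotal_def)

text \<open>The sets \<open>{1..k+1} - {x}\<close> are never deleted: their traces do not contain \<open>m\<close> if \<open>k + 1 < m\<close>,
  and otherwise omit at most one element of \<open>{1..m}\<close>, whereas those in \<open>D\<close> omit at least two.\<close>
lemma keep_small:
  assumes "k + 1 < m \<or> g + 2 \<le> m" and "D \<subseteq> {E \<in> pivotal. card E = g}"
  shows "({1..k+1} - {x}) \<inter> {1..m} \<notin> D"
proof
  assume D: "({1..k+1} - {x}) \<inter> {1..m} \<in> D"
  show False
  proof (cases "k + 1 < m")
    case True
    then have "m \<notin> ({1..k+1} - {x}) \<inter> {1..m}" by auto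
    then show False using D assms by (auto simp: pivotal_def)
  next
    case False
    then have "({1..k+1} - {x}) \<inter> {1..m} = {1..m} - {x}" by auto
    moreover have "m \<le> card ({1..m} - {x}) + 1" by (simp add: card_Diff_singleton_if)
    ultimately show False using D assms False by auto
  qed
qed

lemma pull_class:
  assumes "e + g = m + t" "e \<noteq> g" "k + 1 < m \<or> g + 2 \<le> m"
  shows "card {E \<in> pivotal. card E = e} * (n - m choose (k + 1 - e))
       \<le> card {E \<in> pivotal. card E = g} * (n - m choose (k - g))"
proof -
  let ?X = "\<lambda>e. {E \<in> pivotal. card E = e}"
  have "(\<Sum>E\<in>?X e. n - m choose (k + 1 - card E)) \<le> (\<Sum>E\<in>?X g. n - m choose (k - card E))"
  proof (rule pull)
    fix E G assume "E \<in> ?X e" "G \<in> pivotal" "card (E \<inter> G) = t"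
    then show "G \<in> ?X g" using conflict_sizes[of E G] assms(1) by auto
  next
    show "({1..k+1} - {x}) \<inter> {1..m} \<notin> ?X g" for x using keep_small[OF assms(3)] by blast
  qed (use assms in auto)
  then show ?thesis by simp
qed

text \<open>For \<open>|E| \<noteq> |G|\<close>, pulling either of the two size classes and deleting the other gives two
  inequalities whose product contradicts \<open>binomial_product_strict\<close>.  For \<open>|E| = |G| = t + c\<close>, two
  conflicting traces never omit the same \<open>i < m\<close>; so for each \<open>i\<close> one may pull the traces of the class
  that omit \<open>i\<close> and delete those that contain it.  Every trace omits \<open>c\<close> of these \<open>i\<close>
  and contains \<open>t + c - 1\<close>, and the sum of the inequalities over \<open>i\<close> contradicts \<open>averaging_numbers\<close>.\<close>
lemma no_interior_conflict:
  assumes E: "E \<in> pivotal" and G: "G \<in> pivotal" and c: "card (E \<inter> G) = t" and m: "t + 3 \<le> m"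
    and int: "k + 1 < m \<or> (card E + 2 \<le> m \<and> card G + 2 \<le> m)"
  shows False
proof -
  let ?X = "\<lambda>e. {E \<in> pivotal. card E = e}" and ?N = "n - m"
  let ?e = "card E" and ?g = "card G"
  have eg: "?e + ?g = m + t" using conflict_sizes[OF E G c] by simp
  have ek: "?e \<le> k" "?g \<le> k" using E G tracesD by (auto simp: pivotal_def)
  have NX: "0 < card (?X ?e)" "0 < card (?X ?g)" using E G finite_pivotal by (auto simp: card_gt_0_iff)
  have sE: "k + 1 - ?e = Suc (k - ?e)" "k + 1 - ?g = Suc (k - ?g)" using ek by auto
  have room: "(k - ?e) + (k - ?g) + 2 \<le> ?N" using eg ek n_large m_range by linarith
  show False
  proof (cases "?e = ?g")
    case False
    have 1: "card (?X ?e) * (?N choose Suc (k - ?e)) \<le> card (?X ?g) * (?N choose (k - ?g))"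
      using pull_class[OF eg False] int sE by auto
    have 2: "card (?X ?g) * (?N choose Suc (k - ?g)) \<le> card (?X ?e) * (?N choose (k - ?e))"
      using pull_class[of ?g ?e] eg False int sE by auto
    have "(card (?X ?e) * card (?X ?g)) * ((?N choose Suc (k - ?e)) * (?N choose Suc (k - ?g)))
        = (card (?X ?e) * (?N choose Suc (k - ?e))) * (card (?X ?g) * (?N choose Suc (k - ?g)))"
      by (simp only: mult_ac)
    also have "\<dots> \<le> (card (?X ?g) * (?N choose (k - ?g))) * (card (?X ?e) * (?N choose (k - ?e)))"
      using 1 2 by (rule mult_le_mono)
    also have "\<dots> = (card (?X ?e) * card (?X ?g)) * ((?N choose (k - ?e)) * (?N choose (k - ?g)))"
      by (simp only: mult_ac)
    finally have "(?N choose Suc (k - ?e)) * (?N choose Suc (k - ?g)) \<le> (?N choose (k - ?e)) * (?N choose (k - ?g))"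
      unfolding mult_le_cancel1 using NX by (simp only: nat_0_less_mult_iff simp_thms)
    then show False using binomial_product_strict[OF room] by simp
  next
    case True
    define c where "c = m - ?e"
    have "?e \<le> m" using E tracesD[of E] card_mono[of "{1..m}" E] by (auto simp: pivotal_def)
    then have mc: "m = t + 2 * c" "?e = t + c" using eg True by (auto simp: c_def)
    have c2: "2 \<le> c" using m mc by linarith
    let ?Y = "?X ?e" and ?P = "?N choose (k + 1 - ?e)" and ?R = "?N choose (k - ?e)"
    have Y: "E \<subseteq> {1..m}" "m \<in> E" "card E = t + c" if "E \<in> ?Y" for E
    proof -
      have "E \<in> traces" "m \<in> E" "card E = ?e" using that by (auto simp: pivotal_def)
      then show "E \<subseteq> {1..m}" "m \<in> E" "card E = t + c" using tracesD(1) mc(2) by simp_all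
    qed
    have finY: "finite ?Y" using finite_pivotal by simp
    have step: "card {E \<in> ?Y. i \<notin> E} * ?P \<le> card {E \<in> ?Y. i \<in> E} * ?R" if i: "i \<in> {1..m-1}" for i
    proof -
      have "(\<Sum>E\<in>{E \<in> ?Y. i \<notin> E}. ?N choose (k + 1 - card E)) \<le> (\<Sum>E\<in>{E \<in> ?Y. i \<in> E}. ?N choose (k - card E))"
      proof (rule pull)
        fix E G assume EG: "E \<in> {E \<in> ?Y. i \<notin> E}" "G \<in> pivotal" "card (E \<inter> G) = t"
        then have u: "E \<union> G = {1..m}" "card E + card G = m + t" using conflict_sizes[of E G] by auto
        have "i \<in> E \<union> G" using u(1) i by auto
        moreover have "card G = ?e" using EG u(2) mc by auto
        ultimately show "G \<in> {E \<in> ?Y. i \<in> E}" using EG by auto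
      next
        have "k + 1 < m \<or> ?e + 2 \<le> m" using int by blast
        then show "({1..k+1} - {x}) \<inter> {1..m} \<notin> {E \<in> ?Y. i \<in> E}" for x
          by (rule keep_small) blast
      qed auto
      then show ?thesis by simp
    qed
    \<comment> \<open>double counting of pairs of an element and a trace\<close>
    have count: "(\<Sum>i\<in>{1..m-1}. card {E \<in> ?Y. Q i E}) = (\<Sum>E\<in>?Y. card {i \<in> {1..m-1}. Q i E})" for Q
    proof -
      have "(\<Sum>i\<in>{1..m-1}. card {E \<in> ?Y. Q i E}) = (\<Sum>i\<in>{1..m-1}. \<Sum>E\<in>?Y. if Q i E then 1 else 0)"
        using finY by (intro sum.cong refl) (simp add: sum.If_cases Int_def conj_commute)
      also have "\<dots> = (\<Sum>E\<in>?Y. \<Sum>i\<in>{1..m-1}. if Q i E then 1 else 0)" by (rule sum.swap)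
      also have "\<dots> = (\<Sum>E\<in>?Y. card {i \<in> {1..m-1}. Q i E})"
        by (intro sum.cong refl) (simp add: sum.If_cases Int_def conj_commute)
      finally show ?thesis .
    qed
    have ins: "card {i \<in> {1..m-1}. i \<in> E} = t + c - 1" if "E \<in> ?Y" for E
    proof -
      have "{i \<in> {1..m-1}. i \<in> E} = E - {m}" using Y[OF that] by force
      then show ?thesis using Y[OF that] finite_subset[of E "{1..m}"] by (simp add: card_Diff_singleton)
    qed
    have outs: "card {i \<in> {1..m-1}. i \<notin> E} = c" if "E \<in> ?Y" for E
    proof -
      have "{1..m-1} = {1..m} - {m}" using m by auto
      then have "{i \<in> {1..m-1}. i \<notin> E} = {1..m} - E" using Y[OF that] by blast
      then show ?thesis using Y[OF that] finite_subset[of E "{1..m}"] mc by (simp add: card_Diff_subset)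
    qed
    have "(\<Sum>i\<in>{1..m-1}. card {E \<in> ?Y. i \<notin> E}) * ?P \<le> (\<Sum>i\<in>{1..m-1}. card {E \<in> ?Y. i \<in> E}) * ?R"
      unfolding sum_distrib_right using step by (rule sum_mono)
    then have "(card ?Y * c) * ?P \<le> (card ?Y * (t + c - 1)) * ?R"
      unfolding count using ins outs by simp
    then have "card ?Y * (c * ?P) \<le> card ?Y * ((t + c - 1) * ?R)" by (simp only: mult.assoc)
    then have le: "c * ?P \<le> (t + c - 1) * ?R" using NX by simp
    have "Suc (k - ?e) * ?P = (?N - (k - ?e)) * ?R" unfolding sE by (rule Suc_times_binomial_Suc)
    moreover have "Suc (k - ?e) * (c * ?P) \<le> Suc (k - ?e) * ((t + c - 1) * ?R)" using le by (rule mult_le_mono2)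
    ultimately have "(c * (?N - (k - ?e))) * ?R \<le> ((t + c - 1) * Suc (k - ?e)) * ?R"
      by (metis mult.assoc mult.commute)
    moreover have "0 < ?R" using room by simp
    ultimately have "c * (?N - (k - ?e)) \<le> (t + c - 1) * Suc (k - ?e)" by simp
    moreover have "?N - (k - ?e) = n - k - c" "Suc (k - ?e) = k - t - c + 1" using mc ek by auto
    ultimately show False using averaging_numbers[OF c2] mc ek by simp
  qed
qed

text \<open>An element \<open>j \<ge> t + 2\<close> of \<open>T\<close> could be exchanged for some \<open>i \<le> t + 1\<close>.  The result would be a second
  pivotal trace of size \<open>t + 1\<close> that conflicts with the first, but conflicting sizes add up to
  \<open>m + t\<close>, which exceeds \<open>2 (t + 1)\<close>.\<close>
lemma unique_small_pivotal:
  assumes T: "T \<subseteq> {1..m-1}" "card T = t" "insert m T \<in> pivotal" and m: "t + 3 \<le> m" "m \<le> k + 1"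
  shows "T \<subseteq> {1..t+1}"
proof
  have fT: "finite T" using T finite_subset by auto
  have mT: "m \<notin> T" using T m by auto
  fix j assume j: "j \<in> T"
  show "j \<in> {1..t+1}"
  proof (rule ccontr)
    assume nj: "j \<notin> {1..t+1}"
    then have j2: "t + 2 \<le> j" "j \<noteq> m" using j T mT by auto
    have "\<not> {1..t+1} \<subseteq> T"
    proof
      assume "{1..t+1} \<subseteq> T"
      then have "t + 1 \<le> card T" using fT card_mono[of T "{1..t+1}"] by simp
      then show False using T by simp
    qed
    then obtain i where i: "i \<in> {1..t+1}" "i \<notin> T" by blast
    let ?T = "insert i (T - {j})"
    have cT: "card ?T = t" using card_exchange[OF fT j i(2)] T by simp
    have e: "insert i (insert m T - {j}) = insert m ?T" using j2 by blast
    have "insert m T \<in> traces" using T by (simp add: pivotal_def)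
    then have tr: "insert m ?T \<in> traces"
      using exchange_trace[of "insert m T" j i] j i j2 m unfolding e by auto
    have mT': "m \<notin> ?T" using mT i m by auto
    then have "insert m ?T - {m} = ?T" by blast
    moreover have "?T \<notin> traces" using large_traces[of ?T] cT m by auto
    ultimately have piv: "insert m ?T \<in> pivotal" using tr by (simp add: pivotal_def)
    have "insert m T \<inter> insert m ?T = insert m (T - {j})" using i j by auto
    then have "card (insert m T \<inter> insert m ?T) = t" using fT mT j T t_pos by (simp add: card_Diff_singleton)
    from conflict_sizes(2)[OF T(3) piv this] show False using fT mT mT' cT T m by simp
  qed
qed

text \<open>Here \<open>|E| = m - 1\<close> and \<open>G = T \<union> {m}\<close> with \<open>|T| = t\<close>.  Exchanging \<open>m\<close> turns \<open>G\<close> into \<open>T \<union> {j}\<close> for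
  every other \<open>j\<close> in \<open>{1..m}\<close>, and a trace that omits some \<open>x\<close> in \<open>T\<close> must meet all of these in
  \<open>t\<close> elements, which leaves only \<open>{1..m} - {x}\<close>.\<close>
lemma boundary_conflict:
  assumes E: "E \<in> pivotal" and G: "G \<in> pivotal" and c: "card (E \<inter> G) = t"
    and m: "t + 3 \<le> m" "m \<le> k + 1" and big: "m \<le> card E + 1"
  shows "\<exists>T\<subseteq>{1..m}. card T = t \<and> F \<subseteq> hm_family T ({1..m} - T)"
proof -
  have u: "E \<union> G = {1..m}" and sz: "card E + card G = m + t" using conflict_sizes[OF E G c] .
  have Etr: "E \<in> traces" "m \<in> E" "E - {m} \<notin> traces" and Gtr: "G \<in> traces" "m \<in> G"
    using E G by (auto simp: pivotal_def)
  note Ed = tracesD[OF Etr(1)] and Gd = tracesD[OF Gtr(1)]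
  have co: "{1..m} - {m} \<in> traces"
  proof -
    have "({1..k+1} - {m}) \<inter> {1..m} \<in> traces" using co_trace[of m] m by (auto simp: traces_def)
    moreover have "({1..k+1} - {m}) \<inter> {1..m} = {1..m} - {m}" using m by auto
    ultimately show ?thesis by simp
  qed
  then have "E \<noteq> {1..m}" using Etr by blast
  then have "card E < m" using Ed psubset_card_mono[of "{1..m}" E] by auto
  then have cG: "card G = t + 1" and cE: "card E = m - 1" using big sz by auto
  define T where "T = G - {m}"
  have T: "T \<subseteq> {1..m-1}" "card T = t" "insert m T = G"
    using Gd Gtr cG by (auto simp: T_def card_Diff_singleton)
  have Tm: "T \<subseteq> {1..m}" using Gd(1) by (auto simp: T_def)
  have fT: "finite T" using T finite_subset by auto
  have T1: "T \<subseteq> {1..t+1}" using unique_small_pivotal[OF T(1,2) _ m] T G by simp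
  have star: "insert j T \<in> traces" if j: "j \<in> {1..m} - T" for j
  proof (cases "j = m")
    case True
    then show ?thesis using T Gtr by simp
  next
    case False
    then have "insert j (G - {m}) \<in> traces"
      using j m Gtr T by (intro exchange_trace) auto
    then show ?thesis by (simp add: T_def)
  qed
  have "A \<in> hm_family T ({1..m} - T)" if A: "A \<in> F" for A
  proof -
    have An: "A \<in> nsets {1..n} k" using F_nsets A by blast
    let ?W = "A \<inter> {1..m}"
    have W: "?W \<in> traces" using A by (simp add: traces_def)
    show ?thesis
    proof (cases "T \<subseteq> A")
      case True
      have "A \<inter> ({1..m} - T) \<noteq> {}"
      proof
        assume "A \<inter> ({1..m} - T) = {}"
        then have "?W \<subseteq> T" by blast
        then have "card ?W \<le> t" using card_mono[OF fT] T by blast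
        then show False using large_traces[OF W m(2)] by simp
      qed
      then show ?thesis using True An by (auto simp: hm_family_def)
    next
      case False
      then obtain x where x: "x \<in> T" "x \<notin> A" by blast
      have sub: "insert j (T - {x}) \<subseteq> ?W" if j: "j \<in> {1..m} - T" for j
      proof -
        have "?W \<inter> insert j T \<subseteq> insert j (T - {x})" using x by blast
        moreover have "t \<le> card (?W \<inter> insert j T)" using traces_intersect[OF W star[OF j]] .
        moreover have "card (insert j (T - {x})) = t" using j x T fT t_pos by (simp add: card_Diff_singleton)
        ultimately have "?W \<inter> insert j T = insert j (T - {x})" using fT by (intro card_seteq) auto
        then show ?thesis by blast
      qed
      have "card T < card {1..m}" using T m by simp
      then have "{1..m} - T \<noteq> {}" using card_mono[OF fT, of "{1..m}"] by auto
      then have "{1..m} - {x} \<subseteq> ?W" using sub by blast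
      moreover have "T \<union> ({1..m} - T) = {1..m}" using Tm by blast
      ultimately have "A \<inter> (T \<union> ({1..m} - T)) = T \<union> ({1..m} - T) - {x}" using x by blast
      then show ?thesis using x An by (auto simp: hm_family_def)
    qed
  qed
  then show ?thesis using T(2) Tm by blast
qed

text \<open>Minimality of \<open>m\<close> shows up as two \<open>k\<close>-sets that agree below \<open>m\<close>, only one of which is a member.
  If it were \<open>B\<close> that contains \<open>m\<close>, then \<open>A\<close> would have an element beyond \<open>m\<close> to exchange for \<open>m\<close>.\<close>
lemma pivotal_exists:
  assumes A: "A \<in> F" and B: "B \<in> nsets {1..n} k" "B \<notin> F" and eq: "A \<inter> {1..m-1} = B \<inter> {1..m-1}"
  shows "A \<inter> {1..m} \<in> pivotal" "k + 1 - card (A \<inter> {1..m}) \<le> n - m"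
proof -
  note Ad = F_D[OF A] and Bd = nsetsD[OF B(1)]
  have split: "C \<inter> {1..m} = (if m \<in> C then insert m (C \<inter> {1..m-1}) else C \<inter> {1..m-1})" for C
  proof -
    have "{1..m} = insert m {1..m-1}" using m_range by auto
    then show ?thesis by auto
  qed
  have neq: "A \<inter> {1..m} \<noteq> B \<inter> {1..m}" using determined A B by blast
  have mA: "m \<in> A"
  proof (rule ccontr)
    assume mA: "m \<notin> A"
    then have mB: "m \<in> B" using neq eq split by metis
    have "A \<inter> {1..m} \<subset> B \<inter> {1..m}" using mA mB eq split[of A] split[of B] by auto
    then have "card (A \<inter> {1..m}) < card (B \<inter> {1..m})" by (intro psubset_card_mono) auto
    also have "\<dots> \<le> k" using Bd card_mono[of B "B \<inter> {1..m}"] by auto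
    finally have "\<not> A \<subseteq> {1..m}" using Ad by (metis Int_absorb2 less_irrefl)
    then obtain j where j: "j \<in> A" "j \<notin> {1..m}" by blast
    then have "m < j" using Ad by auto
    let ?A = "insert m (A - {j})"
    have "?A \<in> F" using exchange[OF A j(1) mA] \<open>m < j\<close> m_range by auto
    moreover have "?A \<inter> {1..m} = B \<inter> {1..m}"
      using split[of A] split[of B] mA mB eq j \<open>m < j\<close> m_range by auto
    ultimately show False using determined B by blast
  qed
  then have mB: "m \<notin> B" using neq eq split by metis
  have rem: "A \<inter> {1..m} - {m} = B \<inter> {1..m}" using split[of A] split[of B] mA mB eq m_range by auto
  have "B \<inter> {1..m} \<notin> traces" using B determined by (auto simp: traces_def)
  then show "A \<inter> {1..m} \<in> pivotal" using rem mA A m_range by (auto simp: pivotal_def traces_def)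
  have "B - {1..m} \<subseteq> {m+1..n}" using Bd by auto
  then have "card (B - {1..m}) \<le> n - m" using card_mono[of "{m+1..n}" "B - {1..m}"] by simp
  moreover have "card (B - {1..m}) = k - card (B \<inter> {1..m})" using Bd by (simp add: card_Diff_subset_Int)
  moreover have "card (B \<inter> {1..m}) = card (A \<inter> {1..m}) - 1"
    unfolding rem[symmetric] using mA m_range by (simp add: card_Diff_singleton)
  moreover have "card (A \<inter> {1..m}) \<noteq> 0" using mA m_range by auto
  ultimately show "k + 1 - card (A \<inter> {1..m}) \<le> n - m" by linarith
qed

end

lemma (in parameters) optimal_subset_eq:
  assumes "optimal F" "F \<subseteq> G" "admissible G"
  shows "F = G"
proof -
  have "finite G" using assms(3) finite_subset[of G "nsets {1..n} k"]
    by (auto simp: admissible_def finite_imp_finite_nsets)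
  then show ?thesis using assms by (intro card_seteq) (auto simp: optimal_def)
qed

lemma (in parameters) nearly_shifted_extremal:
  assumes opt: "optimal F"
    and exchange: "\<And>A i j. A \<in> F \<Longrightarrow> j \<in> A \<Longrightarrow> i \<notin> A \<Longrightarrow> 1 \<le> i \<Longrightarrow> i < j \<Longrightarrow> t + 2 \<le> j \<Longrightarrow> insert i (A - {j}) \<in> F"
    and co: "{1..k+1} - {t} \<in> F" "{1..k+1} - {t+1} \<in> F"
  shows "extremal F"
proof -
  define det where "det m \<longleftrightarrow> t + 2 \<le> m \<and>
    (\<forall>A\<in>F. \<forall>B\<in>nsets {1..n} k. A \<inter> {1..m} = B \<inter> {1..m} \<longrightarrow> B \<in> F)" for m
  have Fn: "F \<subseteq> nsets {1..n} k" using opt by (auto simp: optimal_def admissible_def)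
  have "det n"
    unfolding det_def
  proof (intro conjI ballI impI)
    show "t + 2 \<le> n" using n_large t_less_k by linarith
    fix A B assume "A \<in> F" "B \<in> nsets {1..n} k" "A \<inter> {1..n} = B \<inter> {1..n}"
    moreover have "A \<inter> {1..n} = A" "B \<inter> {1..n} = B" using calculation Fn nsetsD(2) by blast+
    ultimately show "B \<in> F" by simp
  qed
  define m where "m = (LEAST m. det m)"
  have m: "det m" "m \<le> n" and least: "\<And>l. det l \<Longrightarrow> m \<le> l"
    using LeastI[of det n] Least_le[of det] \<open>det n\<close> by (auto simp: m_def)
  interpret nearly_shifted n k t F m
  proof
    show "optimal F" "{1..k+1} - {t} \<in> F" "{1..k+1} - {t+1} \<in> F" "m \<le> n" by fact+
    show "insert i (A - {j}) \<in> F" if "A \<in> F" "j \<in> A" "i \<notin> A" "1 \<le> i" "i < j" "t + 2 \<le> j" for A i j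
      using exchange that .
    show "t + 2 \<le> m" using m(1) by (simp add: det_def)
    show "B \<in> F" if "A \<in> F" "B \<in> nsets {1..n} k" "A \<inter> {1..m} = B \<inter> {1..m}" for A B
      using m(1) that unfolding det_def by blast
  qed
  show ?thesis
  proof (cases "m = t + 2")
    case True
    have "F \<subseteq> near_family {1..t+2}"
    proof
      fix A assume A: "A \<in> F"
      then have "A \<inter> {1..m} \<in> traces" by (simp add: traces_def)
      then show "A \<in> near_family {1..t+2}"
        using large_traces t_less_k True A Fn by (auto simp: near_family_def)
    qed
    moreover have Y: "{1..t+2} \<subseteq> {1..n}" "card {1..t+2} = t + 2" using True m by auto
    ultimately have "F = near_family {1..t+2}" using optimal_subset_eq opt admissible_near_family by blast
    then show ?thesis using Y unfolding extremal_def by blast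
  next
    case False
    then have m3: "t + 3 \<le> m" using m by (auto simp: det_def)
    have "\<not> det (m - 1)" using least[of "m - 1"] m3 by auto
    then obtain A B where AB: "A \<in> F" "B \<in> nsets {1..n} k" "B \<notin> F" "A \<inter> {1..m-1} = B \<inter> {1..m-1}"
      using m3 unfolding det_def by auto
    let ?E = "A \<inter> {1..m}"
    have E: "?E \<in> pivotal" "k + 1 - card ?E \<le> n - m" using pivotal_exists[OF AB] .
    obtain G where G: "G \<in> pivotal" "card (?E \<inter> G) = t" using pivotal_partner[OF E] by blast
    have mk: "m \<le> k + 1" using no_interior_conflict[OF E(1) G m3] not_less by blast
    have GE: "card (G \<inter> ?E) = t" using G(2) by (simp add: Int_commute)
    have "\<not> (card ?E + 2 \<le> m \<and> card G + 2 \<le> m)" using no_interior_conflict[OF E(1) G m3] by blast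
    then have "m \<le> card ?E + 1 \<or> m \<le> card G + 1" by linarith
    then obtain T where T: "T \<subseteq> {1..m}" "card T = t" "F \<subseteq> hm_family T ({1..m} - T)"
      using boundary_conflict[OF E(1) G m3 mk] boundary_conflict[OF G(1) E(1) GE m3 mk] by blast
    let ?Q = "{1..m} - T"
    have TQ: "T \<union> ?Q \<subseteq> {1..n}" "T \<inter> ?Q = {}" using T m by auto
    have "finite T" using T finite_subset by auto
    then have cQ: "card ?Q = m - t" using T by (simp add: card_Diff_subset)
    have "F = hm_family T ?Q"
      using optimal_subset_eq[OF opt T(3)] admissible_hm_family[OF TQ T(2)] cQ m3 mk by simp
    moreover have "card ?Q = k + 1 - t"
      by (rule optimal_hm_family[OF _ TQ T(2)]) (use opt calculation cQ m3 mk in auto)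
    ultimately show ?thesis using TQ T unfolding extremal_def by blast
  qed
qed

section \<open>Reduction to nearly shifted families\<close>

lemma permutation_moving_two_sets:
  assumes "finite S" "X \<union> Y \<subseteq> S" "X' \<union> Y' \<subseteq> S" "X \<inter> Y = {}" "X' \<inter> Y' = {}"
    "card X = card X'" "card Y = card Y'"
  shows "\<exists>p. p permutes S \<and> p ` X = X' \<and> p ` Y = Y'"
proof -
  have fin: "finite X" "finite Y" "finite X'" "finite Y'" using assms finite_subset by (meson Un_subset_iff)+
  obtain f where f: "bij_betw f X X'" using finite_same_card_bij fin assms by metis
  obtain g where g: "bij_betw g Y Y'" using finite_same_card_bij fin assms by metis
  have "card (S - (X \<union> Y)) = card (S - (X' \<union> Y'))"
    using assms fin by (simp add: card_Diff_subset card_Un_disjoint)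
  then obtain h where h: "bij_betw h (S - (X \<union> Y)) (S - (X' \<union> Y'))"
    using finite_same_card_bij assms(1) by (metis finite_Diff)
  define p where "p x = (if x \<in> X then f x else if x \<in> Y then g x else if x \<in> S then h x else x)" for x
  have p: "bij_betw p X X'" "bij_betw p Y Y'" "bij_betw p (S - (X \<union> Y)) (S - (X' \<union> Y'))"
  proof -
    show "bij_betw p X X'" using f bij_betw_cong[of X p f] by (simp add: p_def)
    have "p x = g x" if "x \<in> Y" for x using that assms(4) by (auto simp: p_def)
    then show "bij_betw p Y Y'" using g bij_betw_cong[of Y p g] by simp
    show "bij_betw p (S - (X \<union> Y)) (S - (X' \<union> Y'))"
      using h bij_betw_cong[of "S - (X \<union> Y)" p h] by (simp add: p_def)
  qed
  have "bij_betw p (X \<union> Y) (X' \<union> Y')" using p(1,2) assms(5) by (rule bij_betw_combine)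
  then have "bij_betw p (X \<union> Y \<union> (S - (X \<union> Y))) (X' \<union> Y' \<union> (S - (X' \<union> Y')))"
    using p(3) by (rule bij_betw_combine) blast
  moreover have "X \<union> Y \<union> (S - (X \<union> Y)) = S" "X' \<union> Y' \<union> (S - (X' \<union> Y')) = S" using assms by auto
  ultimately have "bij_betw p S S" by simp
  moreover have "p x = x" if "x \<notin> S" for x using that assms(2) by (auto simp: p_def)
  ultimately have "p permutes S" by (rule bij_imp_permutes)
  then show ?thesis using p by (auto simp: bij_betw_def)
qed

context parameters
begin

lemma admissible_image:
  assumes p: "p permutes {1..n}" and F: "admissible F"
  shows "admissible ((`) p ` F)"
  unfolding admissible_def
proof (intro conjI allI impI)
  show "(`) p ` F \<subseteq> nsets {1..n} k" using F permutes_nsets[OF p] by (auto simp: admissible_def)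
  show "t_intersecting t ((`) p ` F)"
    using F card_image[OF permutes_inj_on[OF p]]
    by (auto simp: admissible_def t_intersecting_def simp flip: image_Int[OF permutes_inj[OF p]])
  fix T :: "nat set" assume "card T = t"
  then have "card (inv p ` T) = t" using card_image[OF permutes_inj_on[OF permutes_inv[OF p]]] by simp
  then obtain A where A: "A \<in> F" "\<not> inv p ` T \<subseteq> A" using F unfolding admissible_def by blast
  have "\<not> T \<subseteq> p ` A"
  proof
    assume "T \<subseteq> p ` A"
    then have "inv p ` T \<subseteq> inv p ` (p ` A)" by (rule image_mono)
    then show False using A by (simp add: image_inv_f_f[OF permutes_inj[OF p]])
  qed
  then show "\<not> (\<forall>A\<in>(`) p ` F. T \<subseteq> A)" using A by blast
qed

lemma card_family_image:
  assumes p: "p permutes {1..n}"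
  shows "card ((`) p ` F) = card F"
  by (rule card_image) (meson inj_on_image permutes_inj_on[OF p] inj_onI inj_image_eq_iff permutes_inj[OF p])

lemma optimal_image:
  assumes p: "p permutes {1..n}" and F: "optimal F"
  shows "optimal ((`) p ` F)"
  using F admissible_image[OF p] card_family_image[OF p] by (auto simp: optimal_def)

lemma optimal_shift:
  assumes F: "optimal F" and i: "i \<in> {1..n}"
    and nt: "\<And>T. card T = t \<Longrightarrow> \<not> (\<forall>A\<in>shift i j F. T \<subseteq> A)"
  shows "optimal (shift i j F)"
proof -
  have Fd: "F \<subseteq> nsets {1..n} k" "t_intersecting t F" using F by (auto simp: optimal_def admissible_def)
  have "t_intersecting t (shift i j F)"
    by (rule t_intersecting_shift[OF Fd(2)]) (use Fd(1) nsetsD in blast)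
  then have "admissible (shift i j F)"
    using shift_subset_nsets[OF Fd(1) i] nt by (auto simp: admissible_def)
  then show ?thesis using F by (auto simp: optimal_def card_shift)
qed

text \<open>A member of least element sum with the given trace on \<open>{1..t+1}\<close> has its other elements packed.\<close>
lemma push_down:
  assumes Fn: "F \<subseteq> nsets {1..n} k"
    and exchange: "\<And>A i j. A \<in> F \<Longrightarrow> j \<in> A \<Longrightarrow> i \<notin> A \<Longrightarrow> 1 \<le> i \<Longrightarrow> i < j \<Longrightarrow> t + 2 \<le> j \<Longrightarrow> insert i (A - {j}) \<in> F"
    and "A \<in> F" "card (A \<inter> {1..t+1}) = t"
  shows "(A \<inter> {1..t+1}) \<union> {t+2..k+1} \<in> F"
  using assms(3,4)
proof (induction "\<Sum>A" arbitrary: A rule: less_induct)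
  case less
  have A: "finite A" "A \<subseteq> {1..n}" "card A = k" using less.prems Fn nsetsD by blast+
  let ?W = "(A \<inter> {1..t+1}) \<union> {t+2..k+1}"
  have cW: "card ?W = k" using less.prems t_less_k by (subst card_Un_disjoint) auto
  show ?case
  proof (cases "A \<subseteq> ?W")
    case True
    then have "A = ?W" using cW A card_subset_eq[of ?W A] by auto
    then show ?thesis using less.prems by metis
  next
    case False
    then obtain j where j: "j \<in> A" "j \<notin> ?W" by blast
    then have jk: "k + 1 < j" using A by auto
    have "\<not> ?W \<subseteq> A"
    proof
      assume "?W \<subseteq> A"
      then have "?W = A" using cW A card_subset_eq[of A ?W] by simp
      then show False using j by blast
    qed
    then obtain i where i: "i \<in> ?W" "i \<notin> A" by blast
    then have ik: "t + 2 \<le> i" "i \<le> k + 1" by auto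
    let ?A = "insert i (A - {j})"
    have A': "?A \<in> F" using exchange[OF less.prems(1) j(1) i(2)] ik jk by simp
    have eq: "?A \<inter> {1..t+1} = A \<inter> {1..t+1}" using ik jk t_less_k by auto
    have "\<Sum>?A < \<Sum>A" using sum_exchange_less[OF A(1) j(1) i(2)] ik jk by simp
    then show ?thesis using less.hyps[OF _ A'] less.prems eq by simp
  qed
qed

text \<open>Some member misses an element of \<open>{1..t}\<close>.  One of least element sum among these misses exactly \<open>t\<close>
  from \<open>{1..t+1}\<close>, since every other position allows a further exchange; packing its
  other elements gives \<open>{1..k+1} - {t}\<close>.\<close>
lemma shift_stable_extremal:
  assumes F: "optimal F"
    and stable: "\<And>i j. 1 \<le> i \<Longrightarrow> i < j \<Longrightarrow> j \<le> n \<Longrightarrow> shift i j F = F"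
  shows "extremal F"
proof -
  have Fd: "F \<subseteq> nsets {1..n} k" "\<And>T. card T = t \<Longrightarrow> \<not> (\<forall>A\<in>F. T \<subseteq> A)"
    using F by (auto simp: optimal_def admissible_def)
  have FD: "finite A" "A \<subseteq> {1..n}" "card A = k" if "A \<in> F" for A using that Fd nsetsD by blast+
  have exchange: "insert i (A - {j}) \<in> F" if "A \<in> F" "j \<in> A" "i \<notin> A" "1 \<le> i" "i < j" for A i j
    using shift_stable_exchange[OF stable that(1-3)] that FD[OF that(1)] by auto
  have beyond: "\<exists>j\<in>A. l < j" if "A \<in> F" "l < k" for A l
  proof (rule ccontr)
    assume "\<not> ?thesis"
    then have "A \<subseteq> {1..l}" using FD[OF that(1)] by force
    then show False using FD[OF that(1)] card_mono[of "{1..l}" A] that by simp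
  qed
  have "\<exists>A\<in>F. A \<inter> {1..t+1} = {1..t+1} - {t}" if "A \<in> F" "\<not> {1..t} \<subseteq> A" for A
    using that
  proof (induction "\<Sum>A" arbitrary: A rule: less_induct)
    case less
    have lower: ?case if "j \<in> A" "i \<notin> A" "1 \<le> i" "i < j" "\<not> {1..t} \<subseteq> insert i (A - {j})" for i j
      using less.hyps[OF _ exchange[OF less.prems(1) that(1-4)] that(5)]
        sum_exchange_less[OF FD(1)[OF less.prems(1)] that(1,2,4)] by blast
    obtain s where s: "s \<in> {1..t}" "s \<notin> A" using less.prems by blast
    show ?case
    proof (cases "\<exists>i\<in>{1..t}. i \<noteq> s \<and> i \<notin> A")
      case True
      then obtain i where i: "i \<in> {1..t}" "i \<noteq> s" "i \<notin> A" by blast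
      have "t < k" using t_less_k by simp
      then obtain j where j: "j \<in> A" "t < j" using beyond[OF less.prems(1)] by blast
      have "\<not> {1..t} \<subseteq> insert i (A - {j})" using i s by blast
      then show ?thesis using lower[OF j(1) i(3)] i(1) j(2) by simp
    next
      case one: False
      show ?thesis
      proof (cases "s = t")
        case False
        then have tA: "t \<in> A" using one t_pos by auto
        have "t \<notin> insert s (A - {t})" "t \<in> {1..t}" using False t_pos by auto
        then have "\<not> {1..t} \<subseteq> insert s (A - {t})" by blast
        then show ?thesis using lower[OF tA s(2)] s(1) False by simp
      next
        case st: True
        show ?thesis
        proof (cases "t + 1 \<in> A")
          case True
          have "x \<in> A" if "x \<in> {1..t+1}" "x \<noteq> t" for x
          proof (cases "x = t + 1")
            case False
            then have "x \<in> {1..t}" using that by simp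
            then show ?thesis using one st that by blast
          qed (use True in simp)
          moreover have "t \<notin> A" using s st by simp
          ultimately have "A \<inter> {1..t+1} = {1..t+1} - {t}" by blast
          then show ?thesis using less.prems(1) by (rule bexI)
        next
          case False
          have "t + 1 < k" using t_less_k by simp
          then obtain j where j: "j \<in> A" "t + 1 < j" using beyond[OF less.prems(1)] by blast
          have "t \<notin> insert (t + 1) (A - {j})" "t \<in> {1..t}" using s st by simp_all
          then have "\<not> {1..t} \<subseteq> insert (t + 1) (A - {j})" by blast
          then show ?thesis using lower[OF j(1) False _ j(2)] by simp
        qed
      qed
    qed
  qed
  moreover obtain A where "A \<in> F" "\<not> {1..t} \<subseteq> A" using Fd(2)[of "{1..t}"] by auto
  ultimately obtain A where A: "A \<in> F" "A \<inter> {1..t+1} = {1..t+1} - {t}" by blast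
  have "card ({1..t+1} - {t}) = t" using t_pos by (simp add: card_Diff_singleton)
  then have "({1..t+1} - {t}) \<union> {t+2..k+1} \<in> F" using push_down[OF Fd(1) exchange A(1)] A by simp
  moreover have "({1..t+1} - {t}) \<union> {t+2..k+1} = {1..k+1} - {t}" using t_less_k by auto
  ultimately have co: "{1..k+1} - {t} \<in> F" by simp
  then have "insert t ({1..k+1} - {t} - {t+1}) \<in> F" by (rule exchange) (use t_less_k t_pos in auto)
  moreover have "insert t ({1..k+1} - {t} - {t+1}) = {1..k+1} - {t+1}" using t_pos t_less_k by auto
  ultimately have co': "{1..k+1} - {t+1} \<in> F" by simp
  show ?thesis by (rule nearly_shifted_extremal[OF F _ co co']) (rule exchange)
qed

text \<open>Being largest, \<open>F\<close> contains every \<open>k\<close>-set that includes \<open>{1..t+1}\<close>.  Consequently no shift among the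
  elements from \<open>t + 2\<close> on creates a common \<open>t\<close>-set, and an exchange of such an element for a missing
  one of \<open>{1..t+1}\<close> always leads to a member.\<close>
lemma covered_extremal:
  assumes "optimal F" and "\<And>A. A \<in> F \<Longrightarrow> {1..t-1} \<subseteq> A \<and> t \<le> card (A \<inter> {1..t+1})"
  shows "extremal F"
  using assms
proof (induction "weight F" arbitrary: F rule: less_induct)
  case less
  note F = less.prems(1) and cov = less.prems(2)
  have Fd: "F \<subseteq> nsets {1..n} k" "t_intersecting t F" "\<And>T. card T = t \<Longrightarrow> \<not> (\<forall>A\<in>F. T \<subseteq> A)"
    using F by (auto simp: optimal_def admissible_def)
  have FD: "finite A" "A \<subseteq> {1..n}" "card A = k" if "A \<in> F" for A using that Fd nsetsD by blast+
  have finF: "finite F" using Fd(1) by (rule finite_subset) (simp add: finite_imp_finite_nsets)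
  have sup: "B \<in> F" if B: "B \<in> nsets {1..n} k" "{1..t+1} \<subseteq> B" for B
  proof -
    have fB: "finite B" "card B = k" using nsetsD[OF B(1)] by auto
    have BA: "t \<le> card (B \<inter> A)" if "A \<in> F" for A
    proof -
      have "card (A \<inter> {1..t+1}) \<le> card (B \<inter> A)" using B fB by (intro card_mono) auto
      then show ?thesis using cov[OF that] by simp
    qed
    have "t_intersecting t (insert B F)"
      using BA Fd(2) fB t_less_k by (auto simp: t_intersecting_def Int_commute)
    then have "admissible (insert B F)" using Fd B by (auto simp: admissible_def)
    then have "card (insert B F) \<le> card F" using F by (auto simp: optimal_def)
    then show ?thesis using finF by (auto simp: card_insert_if split: if_splits)
  qed
  show ?case
  proof (cases "\<exists>i j. t + 2 \<le> i \<and> i < j \<and> j \<le> n \<and> shift i j F \<noteq> F")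
    case True
    then obtain i j where ij: "t + 2 \<le> i" "i < j" "j \<le> n" "shift i j F \<noteq> F" by blast
    have "optimal (shift i j F)"
    proof (rule optimal_shift[OF F])
      fix T :: "nat set" assume T: "card T = t"
      show "\<not> (\<forall>A\<in>shift i j F. T \<subseteq> A)"
      proof
        assume "\<forall>A\<in>shift i j F. T \<subseteq> A"
        then have hit: "i \<in> A \<or> j \<in> A" if "A \<in> F" for A
          using t_set_in_shift(4)[OF Fd(3)[OF T], of i j] that ij by auto
        have "card ({1..n} - {i, j}) = n - 2" using ij by (subst card_Diff_subset) auto
        then have "k \<le> card ({1..n} - {i, j})" using n_large t_less_k by linarith
        moreover have "{1..t+1} \<subseteq> {1..n}" "{1..t+1} \<inter> {i, j} = {}" "card {1..t+1} \<le> k"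
          using ij t_less_k n_large by auto
        ultimately obtain B where "B \<in> nsets {1..n} k" "{1..t+1} \<subseteq> B" "B \<inter> {i, j} = {}"
          using nsets_between[of "{1..n}" "{1..t+1}" "{i, j}" k] by auto
        then show False using sup hit by blast
      qed
    qed (use ij in auto)
    moreover have "{1..t-1} \<subseteq> A \<and> t \<le> card (A \<inter> {1..t+1})" if "A \<in> shift i j F" for A
      using that
    proof (cases rule: in_shiftE)
      case (2 B)
      then have "A \<inter> {1..t+1} = B \<inter> {1..t+1}" using ij by auto
      moreover have "{1..t-1} \<subseteq> {1..t+1}" by auto
      ultimately have "{1..t-1} \<subseteq> A" using cov[OF 2(1)] by blast
      then show ?thesis using cov[OF 2(1)] \<open>A \<inter> {1..t+1} = B \<inter> {1..t+1}\<close> by simp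
    qed (use cov in blast)
    moreover have "weight (shift i j F) < weight F"
      using weight_shift_less[OF finF FD(1)] ij by simp
    ultimately have "extremal (shift i j F)" using less.hyps by blast
    then show ?thesis using extremal_unshift[OF Fd(2,1), of i j] ij by simp
  next
    case False
    have exchange: "insert i (A - {j}) \<in> F"
      if "A \<in> F" "j \<in> A" "i \<notin> A" "1 \<le> i" "i < j" "t + 2 \<le> j" for A i j
    proof (cases "t + 2 \<le> i")
      case True
      then show ?thesis using False shift_stable_exchange[of i j F A] that FD(2)[OF that(1)] by auto
    next
      case i: False
      have "A \<inter> {1..t+1} = {1..t+1} - {i}"
      proof (rule card_seteq)
        show "A \<inter> {1..t+1} \<subseteq> {1..t+1} - {i}" using that by blast
        have "card ({1..t+1} - {i}) = t" using i that by (simp add: card_Diff_singleton)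
        then show "card ({1..t+1} - {i}) \<le> card (A \<inter> {1..t+1})" using cov[OF that(1)] by simp
      qed simp
      moreover have "j \<notin> {1..t+1}" using that(6) by simp
      ultimately have "{1..t+1} \<subseteq> insert i (A - {j})" by blast
      moreover have "insert i (A - {j}) \<in> nsets {1..n} k"
        using that FD(2)[OF that(1)] Fd(1) by (intro exchange_in_nsets) auto
      ultimately show ?thesis using sup by blast
    qed
    have co: "{1..k+1} - {x} \<in> F" if x: "{x, y} = {t, t+1}" for x y
    proof -
      have xy: "x \<noteq> y" "x \<in> {t, t+1}" "{1..t+1} = {1..t-1} \<union> {x, y}" "{1..t-1} \<inter> {x, y} = {}"
      proof -
        have "{1..t+1} = {1..t-1} \<union> {t, t+1}" "{1..t-1} \<inter> {t, t+1} = {}" using t_pos by auto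
        then show "{1..t+1} = {1..t-1} \<union> {x, y}" "{1..t-1} \<inter> {x, y} = {}" unfolding x by blast+
        show "x \<in> {t, t+1}" using x by blast
        show "x \<noteq> y" using x by (auto simp: doubleton_eq_iff)
      qed
      have c: "card ({1..t+1} - {z}) = t" if "z \<in> {x, y}" for z
      proof -
        have "z \<in> {1..t+1}" using that xy by blast
        then show ?thesis by (simp add: card_Diff_singleton)
      qed
      obtain A where A: "A \<in> F" "\<not> {1..t+1} - {y} \<subseteq> A" using Fd(3)[OF c[of y]] by blast
      then have "x \<notin> A" using cov[OF A(1)] xy by blast
      have AW: "A \<inter> {1..t+1} = {1..t+1} - {x}"
      proof (rule card_seteq)
        show "A \<inter> {1..t+1} \<subseteq> {1..t+1} - {x}" using \<open>x \<notin> A\<close> by blast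
        show "card ({1..t+1} - {x}) \<le> card (A \<inter> {1..t+1})" using cov[OF A(1)] c[of x] by simp
      qed simp
      have "({1..t+1} - {x}) \<union> {t+2..k+1} \<in> F"
        using push_down[OF Fd(1) exchange A(1)] c[of x] unfolding AW by simp
      moreover have "({1..t+1} - {x}) \<union> {t+2..k+1} = {1..k+1} - {x}" using xy(2) t_less_k by auto
      ultimately show ?thesis by simp
    qed
    have "{1..k+1} - {t} \<in> F" "{1..k+1} - {t+1} \<in> F" using co[of t "t+1"] co[of "t+1" t] by auto
    then show ?thesis using nearly_shifted_extremal[OF F exchange] by blast
  qed
qed

lemma optimal_extremal:
  assumes "optimal F"
  shows "extremal F"
  using assms
proof (induction "weight F" arbitrary: F rule: less_induct)
  case less
  note F = less.prems
  have Fd: "F \<subseteq> nsets {1..n} k" "t_intersecting t F" "\<And>T. card T = t \<Longrightarrow> \<not> (\<forall>A\<in>F. T \<subseteq> A)"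
    using F by (auto simp: optimal_def admissible_def)
  have FD: "finite A" "A \<subseteq> {1..n}" "card A = k" if "A \<in> F" for A using that Fd nsetsD by blast+
  have finF: "finite F" using Fd(1) by (rule finite_subset) (simp add: finite_imp_finite_nsets)
  show ?case
  proof (cases "\<forall>i j. 1 \<le> i \<longrightarrow> i < j \<longrightarrow> j \<le> n \<longrightarrow> shift i j F = F")
    case True
    then show ?thesis using shift_stable_extremal[OF F] by blast
  next
    case False
    then obtain i j where ij: "1 \<le> i" "i < j" "j \<le> n" "shift i j F \<noteq> F" by blast
    show ?thesis
    proof (cases "optimal (shift i j F)")
      case True
      moreover have "weight (shift i j F) < weight F"
        using weight_shift_less[OF finF FD(1)] ij by simp
      ultimately have "extremal (shift i j F)" using less.hyps by blast
      then show ?thesis using extremal_unshift[OF Fd(2,1), of i j] ij by simp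
    next
      case False
      then obtain U where U: "card U = t" "\<forall>A\<in>shift i j F. U \<subseteq> A"
        using optimal_shift[OF F, of i j] ij by auto
      have "i \<noteq> j" using ij by simp
      note Ud = t_set_in_shift[OF Fd(3)[OF U(1)] U(2) this]
      have "card {1..t} = t" by simp
      then obtain A0 where "A0 \<in> F" using Fd(3) by blast
      then have sub: "U - {i} \<subseteq> {1..n}" using Ud(3) FD(2) by blast
      have fU: "finite U" using U t_pos card_ge_0_finite by force
      have cU: "card (U - {i}) = t - 1" using U Ud fU by (simp add: card_Diff_singleton)
      have "{1..t-1} \<union> {t, t+1} \<subseteq> {1..n}" using t_pos t_less_k n_large by auto
      then obtain p where p: "p permutes {1..n}" "p ` (U - {i}) = {1..t-1}" "p ` {i, j} = {t, t+1}"
        using permutation_moving_two_sets[of "{1..n}" "U - {i}" "{i, j}" "{1..t-1}" "{t, t+1}"] sub ij cU Ud t_pos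
        by auto
      have "{1..t-1} \<subseteq> B \<and> t \<le> card (B \<inter> {1..t+1})" if B: "B \<in> (`) p ` F" for B
      proof -
        obtain A where A: "A \<in> F" "B = p ` A" using B by blast
        have 1: "{1..t-1} \<subseteq> B" using A p(2) Ud(3)[OF A(1)] by blast
        obtain y where y: "y \<in> {i, j}" "y \<in> A" using Ud(4)[OF A(1)] by blast
        have py: "p y \<in> {t, t+1}" "p y \<in> B" using p(3) y A by blast+
        then have "insert (p y) {1..t-1} \<subseteq> B \<inter> {1..t+1}" using 1 t_pos by auto
        then have "card (insert (p y) {1..t-1}) \<le> card (B \<inter> {1..t+1})" by (intro card_mono) auto
        then show ?thesis using 1 py t_pos by auto
      qed
      then have "extremal ((`) p ` F)" using covered_extremal[OF optimal_image[OF p(1) F]] by blast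
      then have "extremal ((`) (inv p) ` (`) p ` F)" by (rule extremal_image[OF permutes_inv[OF p(1)]])
      moreover have "(`) (inv p) ` (`) p ` F = F"
        by (simp add: image_comp comp_def image_inv_f_f[OF permutes_inj[OF p(1)]] image_image permutes_inverses(2)[OF p(1)])
      ultimately show ?thesis by simp
    qed
  qed
qed

end

section \<open>Nontrivial multiply intersecting families\<close>

text \<open>If \<open>A \<inter> B\<close> had at most \<open>d - 2\<close> elements, then \<open>A\<close>, \<open>B\<close> and one member avoiding each of these
  elements would be \<open>d\<close> members, up to repetition, with empty intersection.\<close>
lemma pairwise_intersection_of_dwise:
  assumes d: "2 \<le> d" and int: "dwise_t_intersecting d 1 F"
    and fin: "\<And>A. A \<in> F \<Longrightarrow> finite A" and empty: "\<And>x. \<exists>C\<in>F. x \<notin> C"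
  shows "t_intersecting (d - 1) F"
  unfolding t_intersecting_def
proof (intro ballI, rule ccontr)
  fix A B assume AB: "A \<in> F" "B \<in> F" and "\<not> d - 1 \<le> card (A \<inter> B)"
  then have small: "card (A \<inter> B) \<le> d - 2" by simp
  obtain C where C: "\<And>x. C x \<in> F \<and> x \<notin> C x" using empty by metis
  obtain h where h: "bij_betw h {0..<card (A \<inter> B)} (A \<inter> B)"
    using ex_bij_betw_nat_finite[of "A \<inter> B"] fin AB by auto
  \<comment> \<open>Surplus indices get an arbitrary member, namely the value of \<open>C\<close> at an unspecified point.\<close>
  define G where "G i = (if i = 1 then A else if i = 2 then B else C (h (i - 3)))" for i :: nat
  have "\<forall>i\<in>{1..d}. G i \<in> F" using AB C by (auto simp: G_def)
  then have "1 \<le> card (\<Inter>i\<in>{1..d}. G i)" using int by (auto simp: dwise_t_intersecting_def)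
  moreover have "(\<Inter>i\<in>{1..d}. G i) = {}"
  proof (rule ccontr)
    assume "(\<Inter>i\<in>{1..d}. G i) \<noteq> {}"
    then obtain x where x: "\<And>i. i \<in> {1..d} \<Longrightarrow> x \<in> G i" by blast
    have "x \<in> A \<inter> B" using x[of 1] x[of 2] d by (auto simp: G_def)
    then obtain l where l: "l < card (A \<inter> B)" "x = h l" using h by (force simp: bij_betw_def)
    then have "l + 3 \<in> {1..d}" using small by auto
    from x[OF this] show False using C[of x] l by (simp add: G_def)
  qed
  ultimately show False by simp
qed

theorem theorem3:
  fixes n k d :: nat and F :: "nat set set"
  assumes "2 \<le> d" and "d < k"
    and "real n > (1 + real d / 2) * (real k - real d + 2)"
    and "F \<subseteq> nsets {1..n} k"
    and "nontrivial_dwise_intersecting n d F"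
  shows "card F \<le> max (card (H_family n k d)) (card (A_family n k d)) \<and>
         (card F = max (card (H_family n k d)) (card (A_family n k d)) \<longrightarrow>
            isomorphic_families n F (A_family n k d) \<or> isomorphic_families n F (H_family n k d))"
proof -
  define t where "t = d - 1"
  have d: "d = t + 1" using assms(1) by (simp add: t_def)
  have "real ((d + 2) * (k - d + 2)) < real (2 * n)"
    using assms(2,3) by (simp add: field_simps of_nat_diff)
  then have "(d + 2) * (k - d + 2) < 2 * n" by (simp only: of_nat_less_iff)
  moreover have "k + 1 - t = k - d + 2" "t + 3 = d + 2" using assms(2) d by auto
  ultimately have "(t + 3) * (k + 1 - t) < 2 * n" by metis
  then interpret parameters n k t
    by unfold_locales (use assms(1,2) d in auto)
  have fin: "finite A" "A \<subseteq> {1..n}" if "A \<in> F" for A using that assms(4) by (auto simp: nsets_def)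
  have dint: "dwise_t_intersecting d 1 F" and empty: "{1..n} \<inter> \<Inter>F = {}"
    using assms(5) by (auto simp: nontrivial_dwise_t_intersecting_def)
  have "1 \<in> {1..n}" using n_large t_less_k by auto
  then have "F \<noteq> {}" using empty by auto
  then have miss: "\<exists>C\<in>F. x \<notin> C" for x using empty fin by blast
  have "t_intersecting t F"
    using pairwise_intersection_of_dwise[OF assms(1) dint _ miss] fin t_def by simp
  moreover have "\<not> (\<forall>A\<in>F. T \<subseteq> A)" if "card T = t" for T
  proof -
    obtain x where "x \<in> T" using \<open>card T = t\<close> t_pos by (metis card.empty ex_in_conv not_one_le_zero)
    then show ?thesis using miss by blast
  qed
  ultimately have admF: "admissible F" using assms(4) by (auto simp: admissible_def)
  have A_eq: "A_family n k d = near_family {1..d+1}" by (auto simp: A_family_def near_family_def d)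
  have TQ: "{1..d-1} \<union> {d..k+1} = {1..k+1}" "{1..d-1} \<inter> {d..k+1} = {}" using assms(1,2) by auto
  have TQn: "{1..d-1} \<union> {d..k+1} \<subseteq> {1..n}" using TQ n_large t_less_k by auto
  have cTQ: "card {1..d-1} = t" "card {d..k+1} = k + 1 - t" using d by auto
  have H_eq: "H_family n k d = hm_family {1..d-1} {d..k+1}"
  proof
    show "H_family n k d \<subseteq> hm_family {1..d-1} {d..k+1}"
      using co_singleton_in_hm_family[OF TQn TQ(2) cTQ] superset_in_hm_family
      unfolding H_family_def TQ(1) by blast
    show "hm_family {1..d-1} {d..k+1} \<subseteq> H_family n k d"
    proof
      fix A assume A: "A \<in> hm_family {1..d-1} {d..k+1}"
      then have "A \<in> nsets {1..n} k" by (auto simp: hm_family_def)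
      then show "A \<in> H_family n k d"
        using hm_family_cases[OF TQn TQ(2) cTQ A] unfolding H_family_def TQ(1) by blast
    qed
  qed
  have iso: "isomorphic_families n G (A_family n k d) \<or> isomorphic_families n G (H_family n k d)"
    if "extremal G" for G
    using that unfolding extremal_def
  proof (elim disjE exE conjE)
    fix T Q assume G: "T \<union> Q \<subseteq> {1..n}" "T \<inter> Q = {}" "card T = t" "card Q = k + 1 - t" "G = hm_family T Q"
    obtain p where "p permutes {1..n}" "p ` T = {1..d-1}" "p ` Q = {d..k+1}"
      using permutation_moving_two_sets[OF _ G(1) TQn G(2) TQ(2)] G cTQ by auto
    then have "isomorphic_families n G (H_family n k d)"
      using image_permutes_hm_family[of p T Q] G(5) unfolding H_eq isomorphic_families_def by metis
    then show ?thesis by simp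
  next
    fix Y assume G: "Y \<subseteq> {1..n}" "card Y = t + 2" "G = near_family Y"
    have "{1..d+1} \<subseteq> {1..n}" "card Y = card {1..d+1}" using G n_large t_less_k d by auto
    then obtain p where "p permutes {1..n}" "p ` Y = {1..d+1}"
      using permutation_moving_two_sets[of "{1..n}" Y "{}" "{1..d+1}" "{}"] G(1) by auto
    then have "isomorphic_families n G (A_family n k d)"
      using image_permutes_near_family[of p Y] G(3) unfolding A_eq isomorphic_families_def by metis
    then show ?thesis by simp
  qed
  have iso_card: "card G = card G'" if "isomorphic_families n G G'" for G G'
    using that card_family_image by (auto simp: isomorphic_families_def)
  let ?M = "max (card (H_family n k d)) (card (A_family n k d))"
  have bound: "card G \<le> ?M" if "admissible G" for G
  proof -
    have "card G < Suc (card (nsets {1..n} k))" if "admissible G" for G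
      using that card_mono[of "nsets {1..n} k" G] by (simp add: admissible_def finite_imp_finite_nsets less_Suc_eq_le)
    then obtain X where X: "admissible X" "\<forall>G. admissible G \<longrightarrow> card G \<le> card X"
      using ex_has_greatest_nat[of admissible F card "Suc (card (nsets {1..n} k))"] admF by blast
    then have "extremal X" using optimal_extremal by (auto simp: optimal_def)
    then have "card X = card (A_family n k d) \<or> card X = card (H_family n k d)"
      using iso[of X] iso_card[of X] by blast
    then have "card X \<le> ?M" by linarith
    then show ?thesis using X \<open>admissible G\<close> le_trans by blast
  qed
  have "optimal F" if "card F = ?M" using that bound admF by (auto simp: optimal_def)
  then show ?thesis using bound[OF admF] iso optimal_extremal by blast
qed

end
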